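(* Let $C^s_{\mathrm{rad}}$ and $C^t_{\mathrm{rad}}$ be radial clusterings of $X$ with respect to site vectors $s,t\in\mathbb{R}^{d\cdot k}$, respectively (and cluster size bounds $\kappa^-,\kappa^+$). Here $\kappa^-,\kappa^+$ are cluster size bounds such that $\kappa^-\le|C^s_{\mathrm{rad}}|,|C^t_{\mathrm{rad}}|\le\kappa^+$. Let $s^\lambda=(1-\lambda)s+\lambda t$. The algorithm AlgoRadToRad (described in the context), applied to $(C^s_{\mathrm{rad}},C^t_{\mathrm{rad}},s,t,\kappa^-,\kappa^+)$, returns a sequence of clusterings $$(C^{\lambda_0},C^{\lambda_1},\dots,C^{\lambda_r})$$ and a sequence of power diagrams $$(\overline{P}^{\lambda_1},P^{\lambda_1},\overline{P}^{\lambda_2},\dots,P^{\lambda_{r-1}},\overline{P}^{\lambda_r})$$ that satisfy the following properties: 1. $C^{\lambda_0}=C^s_{\mathrm{rad}}$ and $C^{\lambda_r}=C^t_{\mathrm{rad}}$. 2. The $C^{\lambda_i}$ are radial clusterings for sites $s^{\lambda_i}=(1-\lambda_i)s+\lambda_i t$ for all $i\ge0$. 3. All clusterings $C$ in the sequence have cluster sizes satisfying $\kappa_i^-\le|C_i|\le\kappa_i^+$ for all $i\le k$. 4. Consecutive clusterings differ by a single cyclical or sequential exchange of items. 5. $P^{\lambda_i}$ is a separating power diagram for $C^{\lambda_i}$ for sites $\frac12(s^{\lambda_i}+s^{\lambda_{i+1}})$. 6. For consecutive clusterings $C^{\lambda_{i-1}},C^{\lambda_i}$, $\overline{P}^{\lambda_i}$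 is a shared power diagram for sites $s^{\lambda_i}$.
   Context: $X=\{x_1,\dots,x_n\}\subset\mathbb{R}^d$ is a finite set of $n$ distinct items with $\sum_{j=1}^n x_j=0$, and $[k]=\{1,\dots,k\}$. Clusterings. A clustering of $X$ is a partition $C=(C_1,\dots,C_k)$ of $X$ into $k$ (possibly empty) clusters. Its shape is $|C|:=(|C_1|,\dots,|C_k|)$; its clustering vector is $w(C):=(\sum_{x\in C_1}x,\dots,\sum_{x\in C_k}x)\in\mathbb{R}^{d\cdot k}$. Inequalities between shapes and bounds are componentwise. A site vector is $a=(a_1^T,\dots,a_k^T)^T\in\mathbb{R}^{d\cdot k}$ with sites $a_i\in\mathbb{R}^d$. Polytopes and radial clusterings. For bounds $\kappa^-\le\kappa^+$ in $\mathbb{Z}_{\ge0}^k$, $\mathcal{P}^{\pm}(\kappa^-,\kappa^+)=\mathrm{conv}\{w(C):\kappa^-\le|C|\le\kappa^+\}$ (bounded-shape partition polytope) and $\mathcal{T}^{\pm}(\kappa^-,\kappa^+)=\{y\in\mathbb{R}^{n\cdot k}_{\ge 0}:\sum_i y_{ij}=1\ \forall j,\ \kappa_i^-\le\sum_j y_{ij}\le\kappa_i^+\ \forall i\}$ (bounded-shape transportation polytope). The vertices of $\mathcal{T}^\pm$ are exactly the 0/1-vectors $y$ of clusterings with sizes within the bounds ($y_{ij}=1$ iff $x_j\in C_i$), and are identified with these clusterings; clusterings are adjacent if the corresponding vertices share an edge of $\mathcal{T}^\pm$. For a site vector $a$ let $c(a)\in\mathbb{R}^{n\cdot k}$, $c(a)_{ij}=x_j^Ta_i$.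 A clustering $C$ within the bounds is radial for (with respect to) sites $a$ if $w(C)$ maximizes $a^Tw$ over $\mathcal{P}^{\pm}(\kappa^-,\kappa^+)$; equivalently, if its 0/1-vector maximizes $c(a)^Ty$ over $\mathcal{T}^{\pm}(\kappa^-,\kappa^+)$. $N_{\mathcal{T}^\pm}(C)$ denotes the normal cone of $\mathcal{T}^{\pm}(\kappa^-,\kappa^+)$ at the vertex $C$, i.e. the set of all objective vectors maximized over $\mathcal{T}^\pm$ at $C$. Power diagrams. For a site vector $a$ and $\gamma_1,\dots,\gamma_k\in\mathbb{R}$, the power diagram with sites $a$ is $(P_1,\dots,P_k)$ with cells $P_i=\{x\in\mathbb{R}^d:(a_\ell-a_i)^Tx\le\gamma_\ell-\gamma_i\ \forall \ell\in[k]\setminus\{i\}\}$. It is a separating power diagram for $C$ if $C_i\subseteq P_i$ for all $i$, and a shared power diagram for two clusterings if it is separating for both. Exchanges. The clustering difference graph $CDG(C,C')$ is the labeled directed multigraph on $[k]$ with one arc $(i,\ell)$ labeled $x$ for each $i\ne\ell$ and $x\in C_i\cap C'_\ell$. $C$ and $C'$ differ by a single cyclical (sequential) exchange if, up to isolated nodes, $CDG(C,C')$ consists of a single directed cycle (path). Power diagram subroutines. Margin LP for clustering $C$ and sites $a$: maximize $\varepsilon\ge0$ over $\gamma\in\mathbb{R}^k$ with $\gamma_1=0$ subject to $\frac{\max_{x\in C_i}(a_\ell-a_i)^Tx}{\|a_\ell-a_i\|}+\varepsilon\le\frac{\gamma_\ell-\gamma_i}{\|a_\ell-a_i\|}$ for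 all $i\ne\ell$. Shared system for clusterings $C,C'$ and sites $a$: find $\gamma\in\mathbb{R}^k$ with $\gamma_1=0$, $\max_{x\in C_i}(a_\ell-a_i)^Tx\le\gamma_\ell-\gamma_i$ and $\max_{x\in C'_i}(a_\ell-a_i)^Tx\le\gamma_\ell-\gamma_i$ for all $i\ne\ell$. In both cases $a$ and the solution $\gamma$ define a power diagram. AlgoRadToRad$(C^s_{\mathrm{rad}},C^t_{\mathrm{rad}},s,t,\kappa^-,\kappa^+)$: set $\lambda=\lambda_0=0$, $r=0$, $C^{\lambda_0}=C^s_{\mathrm{rad}}$. While $C^{\lambda_r}\ne C^t_{\mathrm{rad}}$: increase $\lambda$ to the next ranging breakpoint (the value beyond which the current vertex $C^{\lambda_r}$ is no longer optimal for the objective $c(s^\lambda)=(1-\lambda)c(s)+\lambda c(t)$ over $\mathcal{T}^\pm(\kappa^-,\kappa^+)$), such that $c(s^\lambda)\in N_{\mathcal{T}^{\pm}}(C^{\lambda_r})\cap N_{\mathcal{T}^{\pm}}(C^\lambda)$ for some adjacent vertex/clustering $C^\lambda\ne C^{\lambda_r}$; set $r\leftarrow r+1$, $\lambda_r\leftarrow\lambda$, $C^{\lambda_r}\leftarrow C^\lambda$; obtain $\overline{P}^{\lambda_r}$ from the shared system for $C^{\lambda_{r-1}},C^{\lambda_r}$ and sites $s^{\lambda_r}$; if $r\ge2$, obtain $P^{\lambda_{r-1}}$ from the margin LP for $C^{\lambda_{r-1}}$ and sites $\frac12(s^{\lambda_{r-1}}+s^{\lambda_r})$. Return $(C^{\lambda_0},\dots,C^{\lambda_r})$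 and $(\overline{P}^{\lambda_1},P^{\lambda_1},\overline{P}^{\lambda_2},\dots,P^{\lambda_{r-1}},\overline{P}^{\lambda_r})$.
   Formalization: Breakpoints are capped at λ=1 (for s=t none exists); margin LP constraints are multiplied by the norm, and any feasible solution serves if it is unbounded; as free choices of adjacent vertices may cycle, "returns" means a return is always reachable and every return satisfies 1–6. *)

theory Defs
  imports "HOL-Analysis.Analysis" "Graph_Theory.Arc_Walk"
begin

(* [n] and [k] are finite types 'n and 'k, and 'k is linearly ordered so that it has a
   first label. The items are enumerated by x :: 'n => real^'d, so that X = range x.
   R^(d*k) is real^'d^'k and R^(n*k) is real^'n^'k, with y $ i $ j for the entry y_ij. *)

section \<open>Clusterings and polytopes\<close>

definition clustering :: "(real^'d) set \<Rightarrow> ('k \<Rightarrow> (real^'d) set) \<Rightarrow> bool" where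
  "clustering X C \<longleftrightarrow> (\<Union>i. C i) = X \<and> (\<forall>i l. i \<noteq> l \<longrightarrow> C i \<inter> C l = {})"

definition within_bounds :: "('k \<Rightarrow> nat) \<Rightarrow> ('k \<Rightarrow> nat) \<Rightarrow> ('k \<Rightarrow> (real^'d) set) \<Rightarrow> bool" where
  "within_bounds kmin kmax C \<longleftrightarrow> (\<forall>i. kmin i \<le> card (C i) \<and> card (C i) \<le> kmax i)"

definition clustering_vector :: "('k \<Rightarrow> (real^'d) set) \<Rightarrow> real^'d^'k" where
  "clustering_vector C = (\<chi> i. \<Sum>z\<in>C i. z)"

definition partition_polytope ::
  "(real^'d) set \<Rightarrow> ('k \<Rightarrow> nat) \<Rightarrow> ('k \<Rightarrow> nat) \<Rightarrow> (real^'d^'k) set" where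
  "partition_polytope X kmin kmax =
     convex hull {clustering_vector C | C. clustering X C \<and> within_bounds kmin kmax C}"

definition radial ::
  "(real^'d) set \<Rightarrow> ('k \<Rightarrow> nat) \<Rightarrow> ('k \<Rightarrow> nat) \<Rightarrow> real^'d^'k \<Rightarrow> ('k \<Rightarrow> (real^'d) set) \<Rightarrow> bool" where
  "radial X kmin kmax a C \<longleftrightarrow>
     clustering X C \<and> within_bounds kmin kmax C \<and>
     (\<forall>w\<in>partition_polytope X kmin kmax. a \<bullet> w \<le> a \<bullet> clustering_vector C)"

definition transportation_polytope ::
  "('k \<Rightarrow> nat) \<Rightarrow> ('k \<Rightarrow> nat) \<Rightarrow> (real^'n^'k) set" where
  "transportation_polytope kmin kmax =
     {y. (\<forall>i j. 0 \<le> y $ i $ j) \<and> (\<forall>j. (\<Sum>i\<in>UNIV. y $ i $ j) = 1) \<and>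
         (\<forall>i. real (kmin i) \<le> (\<Sum>j\<in>UNIV. y $ i $ j) \<and> (\<Sum>j\<in>UNIV. y $ i $ j) \<le> real (kmax i))}"

definition indicator_vector :: "('n \<Rightarrow> real^'d) \<Rightarrow> ('k \<Rightarrow> (real^'d) set) \<Rightarrow> real^'n^'k" where
  "indicator_vector x C = (\<chi> i j. if x j \<in> C i then 1 else 0)"

definition objective :: "('n \<Rightarrow> real^'d) \<Rightarrow> real^'d^'k \<Rightarrow> real^'n^'k" where
  "objective x a = (\<chi> i j. x j \<bullet> (a $ i))"

definition normal_cone ::
  "('n \<Rightarrow> real^'d) \<Rightarrow> ('k \<Rightarrow> nat) \<Rightarrow> ('k \<Rightarrow> nat) \<Rightarrow> ('k \<Rightarrow> (real^'d) set) \<Rightarrow> (real^'n^'k) set" where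
  "normal_cone x kmin kmax C =
     {c. \<forall>y\<in>transportation_polytope kmin kmax. c \<bullet> y \<le> c \<bullet> indicator_vector x C}"

definition adjacent ::
  "('n::finite \<Rightarrow> real^'d) \<Rightarrow> ('k::finite \<Rightarrow> nat) \<Rightarrow> ('k \<Rightarrow> nat) \<Rightarrow> ('k \<Rightarrow> (real^'d) set) \<Rightarrow> ('k \<Rightarrow> (real^'d) set) \<Rightarrow> bool" where
  "adjacent x kmin kmax C C' \<longleftrightarrow>
     clustering (range x) C \<and> within_bounds kmin kmax C \<and>
     clustering (range x) C' \<and> within_bounds kmin kmax C' \<and> C \<noteq> C' \<and>
     (\<exists>e. e edge_of transportation_polytope kmin kmax \<and>
          indicator_vector x C \<in> e \<and> indicator_vector x C' \<in> e)"

section \<open>Power diagrams\<close>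

definition power_diagram :: "real^'d^'k \<Rightarrow> real^'k \<Rightarrow> 'k \<Rightarrow> (real^'d) set" where
  "power_diagram a \<gamma> i = {z. \<forall>l. l \<noteq> i \<longrightarrow> (a $ l - a $ i) \<bullet> z \<le> \<gamma> $ l - \<gamma> $ i}"

definition separating_power_diagram ::
  "real^'d^'k \<Rightarrow> ('k \<Rightarrow> (real^'d) set) \<Rightarrow> ('k \<Rightarrow> (real^'d) set) \<Rightarrow> bool" where
  "separating_power_diagram a P C \<longleftrightarrow> (\<exists>\<gamma>. P = power_diagram a \<gamma>) \<and> (\<forall>i. C i \<subseteq> P i)"

definition shared_power_diagram ::
  "real^'d^'k \<Rightarrow> ('k \<Rightarrow> (real^'d) set) \<Rightarrow> ('k \<Rightarrow> (real^'d) set) \<Rightarrow> ('k \<Rightarrow> (real^'d) set) \<Rightarrow> bool" where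
  "shared_power_diagram a P C C' \<longleftrightarrow>
     separating_power_diagram a P C \<and> separating_power_diagram a P C'"

section \<open>Clustering difference graphs\<close>

(* An arc (i, l, z) runs from i to l and carries the label z. *)
definition CDG ::
  "('k \<Rightarrow> (real^'d) set) \<Rightarrow> ('k \<Rightarrow> (real^'d) set) \<Rightarrow> ('k, 'k \<times> 'k \<times> (real^'d)) pre_digraph" where
  "CDG C C' = \<lparr> verts = UNIV,
                arcs = {(i, l, z). i \<noteq> l \<and> z \<in> C i \<inter> C' l},
                tail = (\<lambda>(i, l, z). i),
                head = (\<lambda>(i, l, z). l) \<rparr>"

definition single_cyclical_exchange ::
  "('k \<Rightarrow> (real^'d) set) \<Rightarrow> ('k \<Rightarrow> (real^'d) set) \<Rightarrow> bool" where
  "single_cyclical_exchange C C' \<longleftrightarrow>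
     (\<exists>p. pre_digraph.cycle (CDG C C') p \<and> set p = arcs (CDG C C'))"

(* The empty walk is excluded: it would make equal clusterings differ by an exchange. *)
definition single_sequential_exchange ::
  "('k \<Rightarrow> (real^'d) set) \<Rightarrow> ('k \<Rightarrow> (real^'d) set) \<Rightarrow> bool" where
  "single_sequential_exchange C C' \<longleftrightarrow>
     (\<exists>u p v. p \<noteq> [] \<and> pre_digraph.apath (CDG C C') u p v \<and> set p = arcs (CDG C C'))"

section \<open>Power diagram subroutines\<close>

definition first_label :: "'k::{finite,linorder}" where
  "first_label = Min UNIV"

(* In both systems max over z in C i is expanded into one inequality for each z, so an empty
   cluster (max = -infinity) gives no constraint. *)

definition shared_system ::
  "real^'d^'k::{finite,linorder} \<Rightarrow> ('k \<Rightarrow> (real^'d) set) \<Rightarrow> ('k \<Rightarrow> (real^'d) set) \<Rightarrow> real^'k::{finite,linorder} \<Rightarrow> bool" where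
  "shared_system a C C' \<gamma> \<longleftrightarrow>
     \<gamma> $ first_label = 0 \<and>
     (\<forall>i l. i \<noteq> l \<longrightarrow>
        (\<forall>z\<in>C i. (a $ l - a $ i) \<bullet> z \<le> \<gamma> $ l - \<gamma> $ i) \<and>
        (\<forall>z\<in>C' i. (a $ l - a $ i) \<bullet> z \<le> \<gamma> $ l - \<gamma> $ i))"

(* The constraints of the margin LP are multiplied by norm (a $ l - a $ i). For distinct sites
   this changes nothing; for coinciding sites the quotients would be 0/0, whereas the product
   form is the separation condition itself. *)
definition margin_feasible ::
  "real^'d^'k::{finite,linorder} \<Rightarrow> ('k \<Rightarrow> (real^'d) set) \<Rightarrow> real^'k::{finite,linorder} \<Rightarrow> real \<Rightarrow> bool" where
  "margin_feasible a C \<gamma> \<epsilon> \<longleftrightarrow>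
     \<gamma> $ first_label = 0 \<and> 0 \<le> \<epsilon> \<and>
     (\<forall>i l. i \<noteq> l \<longrightarrow>
        (\<forall>z\<in>C i. (a $ l - a $ i) \<bullet> z + \<epsilon> * norm (a $ l - a $ i) \<le> \<gamma> $ l - \<gamma> $ i))"

(* An optimal solution; if the LP is unbounded (for instance if all items lie in one cluster),
   any feasible solution. *)
definition margin_solution ::
  "real^'d^'k::{finite,linorder} \<Rightarrow> ('k \<Rightarrow> (real^'d) set) \<Rightarrow> real^'k::{finite,linorder} \<Rightarrow> bool" where
  "margin_solution a C \<gamma> \<longleftrightarrow>
     (\<exists>\<epsilon>. margin_feasible a C \<gamma> \<epsilon> \<and>
        (bdd_above {\<epsilon>'. \<exists>\<gamma>'. margin_feasible a C \<gamma>' \<epsilon>'} \<longrightarrow>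
           (\<forall>\<gamma>' \<epsilon>'. margin_feasible a C \<gamma>' \<epsilon>' \<longrightarrow> \<epsilon>' \<le> \<epsilon>)))"

section \<open>The algorithm\<close>

definition sites_at :: "real^'d^'k \<Rightarrow> real^'d^'k \<Rightarrow> real \<Rightarrow> real^'d^'k" where
  "sites_at s t lam = (1 - lam) *\<^sub>R s + lam *\<^sub>R t"

(* The parameter ranges over [0,1]. If C stays optimal up to 1, the next breakpoint is 1;
   this matters only if several clusterings are radial for t. *)
definition next_breakpoint ::
  "('n::finite \<Rightarrow> real^'d) \<Rightarrow> ('k::finite \<Rightarrow> nat) \<Rightarrow> ('k \<Rightarrow> nat) \<Rightarrow> real^'d^'k \<Rightarrow> real^'d^'k \<Rightarrow>
   ('k \<Rightarrow> (real^'d) set) \<Rightarrow> real \<Rightarrow> real \<Rightarrow> bool" where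
  "next_breakpoint x kmin kmax s t C lam \<mu> \<longleftrightarrow>
     lam \<le> \<mu> \<and> \<mu> \<le> 1 \<and>
     objective x (sites_at s t \<mu>) \<in> normal_cone x kmin kmax C \<and>
     (\<forall>\<nu>. \<mu> < \<nu> \<and> \<nu> \<le> 1 \<longrightarrow> objective x (sites_at s t \<nu>) \<notin> normal_cone x kmin kmax C)"

(* A state consists of the values \<lambda>_0, ..., \<lambda>_r, the clusterings C^(\<lambda>_0), ..., C^(\<lambda>_r) and the
   power diagrams found so far, in the order in which they are returned. *)
type_synonym ('d, 'k) state =
  "real list \<times> ('k \<Rightarrow> (real^'d) set) list \<times> ('k \<Rightarrow> (real^'d) set) list"

definition rad_init :: "('k \<Rightarrow> (real^'d) set) \<Rightarrow> ('d, 'k) state" where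
  "rad_init Cs = ([0], [Cs], [])"

(* One iteration of the while loop. The number of the iteration is length Cls, so the margin LP
   is solved if 2 \<le> length Cls. The choice of the adjacent clustering and of the solutions of
   the two subproblems is left open. *)
inductive rad_step ::
  "('n::finite \<Rightarrow> real^'d) \<Rightarrow> ('k \<Rightarrow> nat) \<Rightarrow> ('k \<Rightarrow> nat) \<Rightarrow> real^'d^'k::{finite,linorder} \<Rightarrow> real^'d^'k::{finite,linorder} \<Rightarrow>
   ('k \<Rightarrow> (real^'d) set) \<Rightarrow> ('d, 'k) state \<Rightarrow> ('d, 'k) state \<Rightarrow> bool"
  for x kmin kmax s t Ct where
  "\<lbrakk> last Cls \<noteq> Ct;
     next_breakpoint x kmin kmax s t (last Cls) (last ls) \<mu>;
     adjacent x kmin kmax (last Cls) C';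
     objective x (sites_at s t \<mu>) \<in>
       normal_cone x kmin kmax (last Cls) \<inter> normal_cone x kmin kmax C';
     shared_system (sites_at s t \<mu>) (last Cls) C' \<gamma>;
     m = (1/2) *\<^sub>R (sites_at s t (last ls) + sites_at s t \<mu>);
     if 2 \<le> length Cls
       then \<exists>\<delta>. margin_solution m (last Cls) \<delta> \<and> Ps = [power_diagram m \<delta>]
       else Ps = [] \<rbrakk>
   \<Longrightarrow> rad_step x kmin kmax s t Ct (ls, Cls, Ds)
        (ls @ [\<mu>], Cls @ [C'], Ds @ Ps @ [power_diagram (sites_at s t \<mu>) \<gamma>])"

definition rad_reaches ::
  "('n::finite \<Rightarrow> real^'d) \<Rightarrow> ('k \<Rightarrow> nat) \<Rightarrow> ('k \<Rightarrow> nat) \<Rightarrow> real^'d^'k::{finite,linorder} \<Rightarrow> real^'d^'k::{finite,linorder} \<Rightarrow>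
   ('k \<Rightarrow> (real^'d) set) \<Rightarrow> ('d, 'k) state \<Rightarrow> ('d, 'k) state \<Rightarrow> bool" where
  "rad_reaches x kmin kmax s t Ct = (rad_step x kmin kmax s t Ct)\<^sup>*\<^sup>*"

definition rad_final :: "('k \<Rightarrow> (real^'d) set) \<Rightarrow> ('d, 'k) state \<Rightarrow> bool" where
  "rad_final Ct st \<longleftrightarrow> last (fst (snd st)) = Ct"

definition algo_rad_to_rad_returns ::
  "('n::finite \<Rightarrow> real^'d) \<Rightarrow> ('k \<Rightarrow> (real^'d) set) \<Rightarrow> ('k \<Rightarrow> (real^'d) set) \<Rightarrow>
   real^'d^'k::{finite,linorder} \<Rightarrow> real^'d^'k::{finite,linorder} \<Rightarrow> ('k \<Rightarrow> nat) \<Rightarrow> ('k \<Rightarrow> nat) \<Rightarrow>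
   ('d, 'k) state \<Rightarrow> bool" where
  "algo_rad_to_rad_returns x Cs Ct s t kmin kmax st \<longleftrightarrow>
     rad_reaches x kmin kmax s t Ct (rad_init Cs) st \<and> rad_final Ct st"

end

theory Submission
  imports Defs
begin

text \<open>
  If \<open>y\<close> is a point of the transportation polytope \<open>T\<close> other than the clustering \<open>C\<close>, draw an arc
  from \<open>i\<close> to \<open>l\<close> for every item of \<open>C i\<close> of which \<open>y\<close> assigns a positive fraction to \<open>l\<close>. This
  digraph contains a cycle, or a path from a node without incoming arcs to a node without outgoing
  arcs. Moving the items along it turns \<open>C\<close> into another clustering within the bounds, and moving
  a small fraction back keeps \<open>y\<close> in \<open>T\<close>. Iterating this writes \<open>y - C\<close> as a nonnegative
  combination of such exchanges, so \<open>T\<close> is the convex hull of the clusterings; applied to two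
  adjacent vertices it shows that the whole difference graph is a single cycle or path.

  A run reaches the target because, at a breakpoint below 1, some edge in the optimal face improves
  the objective \<open>c(t) - c(s)\<close>, and once \<open>\<lambda> = 1\<close> some edge in the optimal face increases the number
  of items on which \<open>C\<close> agrees with the target. Both quantities take finitely many values. The
  shared system and the margin linear program are solvable because an optimal solution of the dual
  of the transportation problem is complementary to all optimal clusterings at once.
\<close>

section \<open>Walks in finite digraphs\<close>

lemma (in wf_digraph) sum_list_awalk_telescope:
  fixes f :: "'a \<Rightarrow> 'c::ab_group_add"
  assumes "awalk u p v"
  shows "(\<Sum>e\<leftarrow>p. f (head G e) - f (tail G e)) = f v - f u"
  using assms by (induction p arbitrary: u) (auto simp: awalk_simps)

lemma (in wf_digraph) not_apath_imp_cycle: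
  assumes "awalk u p v" and "\<not> apath u p v"
  shows "\<exists>c. cycle c"
proof -
  from assms have "\<not> distinct (awalk_verts u p)" by (simp add: apath_def)
  then obtain r where "closed_w r" using awalk_cyc_decompE'[OF assms(1)] by metis
  then show ?thesis using closed_w_imp_cycle by metis
qed

text \<open>Without cycles every walk is a path. An arc into the first node or out of the last node
  of a longest path would prolong it, so its ends are a source and a sink.\<close>

lemma (in fin_digraph) cycle_or_source_sink_apath:
  assumes "arcs G \<noteq> {}"
  shows "(\<exists>p. cycle p) \<or>
         (\<exists>u p v. p \<noteq> [] \<and> apath u p v \<and> (\<forall>e\<in>arcs G. head G e \<noteq> u \<and> tail G e \<noteq> v))"
proof (rule disjCI)
  assume "\<not> (\<exists>u p v. p \<noteq> [] \<and> apath u p v \<and> (\<forall>e\<in>arcs G. head G e \<noteq> u \<and> tail G e \<noteq> v))"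
  then have ext: "\<exists>e\<in>arcs G. head G e = u \<or> tail G e = v" if "apath u p v" "p \<noteq> []" for u p v
    using that by blast
  show "\<exists>p. cycle p"
  proof (rule ccontr)
    assume "\<nexists>p. cycle p"
    then have apathI: "apath u p v" if "awalk u p v" for u p v
      using not_apath_imp_cycle[OF that] by blast
    obtain e where e: "e \<in> arcs G" using assms by auto
    have ne: "\<exists>u v. apath u [e] v" using apathI arc_implies_awalk[OF e] by blast
    let ?Q = "\<lambda>p. p \<noteq> [] \<and> (\<exists>u v. apath u p v)"
    have Q: "?Q [e]" using ne by simp
    have "\<forall>p. ?Q p \<longrightarrow> length p < card (verts G)" using length_apath_less by blast
    from ex_has_greatest_nat[of ?Q, OF Q this]
    obtain p where "?Q p" and max: "\<And>q. ?Q q \<Longrightarrow> length q \<le> length p" by blast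
    then obtain u v where p: "p \<noteq> []" "apath u p v" by blast
    then obtain a where a: "a \<in> arcs G" "head G a = u \<or> tail G a = v" using ext by blast
    have aw: "awalk u p v" using p by (simp add: apath_def)
    from a(2) have "\<exists>q. ?Q q \<and> length q = Suc (length p)"
    proof
      assume "head G a = u"
      then have "awalk (tail G a) (a # p) v" using a(1) aw by (simp add: awalk_simps)
      from apathI[OF this] show ?thesis by (intro exI[of _ "a # p"]) auto
    next
      assume "tail G a = v"
      then have "awalk u (p @ [a]) (head G a)"
        using awalk_appendI[OF aw] arc_implies_awalk[OF a(1)] by simp
      from apathI[OF this] show ?thesis by (intro exI[of _ "p @ [a]"]) auto
    qed
    then show False using max by fastforce
  qed
qed

lemma (in wf_digraph) apath_distinct_tails: "apath u p v \<Longrightarrow> distinct (map (tail G) p)"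
  unfolding apath_def awalk_verts_conv by (simp split: if_splits)

text \<open>By definition a cycle has distinct heads. Its vertex sequence is \<open>u\<close>
  followed by the heads and also the tails followed by \<open>u\<close>, so tails and heads form the
  same multiset.\<close>

lemma (in wf_digraph) cycle_distinct_tails:
  assumes "cycle p"
  obtains u where "awalk u p u" "distinct (map (tail G) p)"
proof -
  obtain u where u: "awalk u p u" "distinct (tl (awalk_verts u p))" "p \<noteq> []"
    using assms unfolding cycle_def by metis
  have cas: "cas u p u" using u(1) by (simp add: awalk_def)
  have heads: "awalk_verts u p = u # map (head G) p"
    unfolding awalk_verts_conv'[OF cas] using cas u(3) by (cases p) (simp_all add: cas_simp)
  have tails: "awalk_verts u p = map (tail G) p @ [head G (last p)]"
    unfolding awalk_verts_conv using u(3) by simp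
  have "last (awalk_verts u p) = u" using u(1) by (metis awalkE')
  then have "awalk_verts u p = map (tail G) p @ [u]" unfolding tails by simp
  then have "mset (map (tail G) p @ [u]) = mset (u # map (head G) p)" using heads by metis
  then have "mset (map (tail G) p) = mset (map (head G) p)" by simp
  moreover have "distinct (map (head G) p)" using u(2) heads by simp
  ultimately have "distinct (map (tail G) p)" by (metis mset_eq_imp_distinct_iff)
  then show thesis using that[OF u(1)] by simp
qed

section \<open>Linear inequalities and polytopes\<close>

text \<open>The question is whether \<open>(0, 1)\<close> lies in the closed cone generated by the
  vectors \<open>(a i, b i)\<close>. If so, the coefficients are the certificate \<open>w\<close>;
  if not, a separating hyperplane yields \<open>g\<close>.\<close>

lemma farkas_alternative:
  fixes a :: "'i \<Rightarrow> 'a::euclidean_space" and b :: "'i \<Rightarrow> real"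
  assumes "finite I"
  obtains g where "\<And>i. i \<in> I \<Longrightarrow> b i \<le> a i \<bullet> g"
  | w where "\<And>i. i \<in> I \<Longrightarrow> 0 \<le> w i" "(\<Sum>i\<in>I. w i *\<^sub>R a i) = 0" "(\<Sum>i\<in>I. w i * b i) = 1"
proof (cases "((0::'a), 1) \<in> convex_cone hull ((\<lambda>i. (a i, b i)) ` I)")
  case True
  define K where "K = {\<Sum>i\<in>I. w i *\<^sub>R (a i, b i) | w. \<forall>i\<in>I. 0 \<le> w i}"
  have "convex_cone hull ((\<lambda>i. (a i, b i)) ` I) \<subseteq> K"
  proof (rule hull_minimal)
    show "(\<lambda>i. (a i, b i)) ` I \<subseteq> K"
    proof clarify
      fix i assume i: "i \<in> I"
      have "(\<Sum>j\<in>I. (if j = i then 1 else 0) *\<^sub>R (a j, b j)) = (\<Sum>j\<in>I. if j = i then (a j, b j) else 0)"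
        by (rule sum.cong) (auto simp: zero_prod_def)
      also have "\<dots> = (a i, b i)" using i assms by simp
      finally show "(a i, b i) \<in> K" unfolding K_def
        by (intro CollectI exI[of _ "\<lambda>j. if j = i then 1 else 0"]) auto
    qed
    show "convex_cone K"
      unfolding convex_cone_iff
    proof (intro conjI ballI allI impI)
      show "0 \<in> K" unfolding K_def by (intro CollectI exI[of _ "\<lambda>_. 0"]) (simp add: zero_prod_def[symmetric])
    next
      fix y z assume "y \<in> K" "z \<in> K"
      then obtain w w' where "y = (\<Sum>i\<in>I. w i *\<^sub>R (a i, b i))" "\<forall>i\<in>I. 0 \<le> w i"
        "z = (\<Sum>i\<in>I. w' i *\<^sub>R (a i, b i))" "\<forall>i\<in>I. 0 \<le> w' i" unfolding K_def by blast
      then show "y + z \<in> K" unfolding K_def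
        by (intro CollectI exI[of _ "\<lambda>i. w i + w' i"]) (simp only: scaleR_left_distrib sum.distrib, simp)
    next
      fix y and c :: real assume "y \<in> K" "0 \<le> c"
      then obtain w where "y = (\<Sum>i\<in>I. w i *\<^sub>R (a i, b i))" "\<forall>i\<in>I. 0 \<le> w i"
        unfolding K_def by blast
      then show "c *\<^sub>R y \<in> K" unfolding K_def using \<open>0 \<le> c\<close>
        by (intro CollectI exI[of _ "\<lambda>i. c * w i"]) (simp only: scaleR_sum_right scaleR_scaleR, simp)
    qed
  qed
  then obtain w where w: "\<forall>i\<in>I. 0 \<le> w i" "(0, 1) = (\<Sum>i\<in>I. w i *\<^sub>R (a i, b i))"
    using True unfolding K_def by auto
  have "(\<Sum>i\<in>I. w i *\<^sub>R a i) = 0" "(\<Sum>i\<in>I. w i * b i) = 1"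
    using arg_cong[OF w(2), of fst] arg_cong[OF w(2), of snd] by (simp_all add: fst_sum snd_sum)
  then show thesis using w(1) that(2) by blast
next
  case False
  let ?K = "convex_cone hull ((\<lambda>i. (a i, b i)) ` I)"
  have "closed ?K" using closed_convex_cone_hull[OF finite_imageI[OF assms]] .
  then obtain h \<beta> where h: "h \<bullet> (0, 1) < \<beta>" "\<And>k. k \<in> ?K \<Longrightarrow> \<beta> < h \<bullet> k"
    using separating_hyperplane_closed_point[OF convex_convex_cone_hull _ False] by blast
  have \<beta>: "\<beta> < 0" using h(2)[OF convex_cone_hull_contains_0] by simp
  \<comment> \<open>A vector of negative value could be rescaled within the cone to have value
    exactly \<open>\<beta>\<close>, against strict separation.\<close>
  have nonneg: "0 \<le> h \<bullet> k" if k: "k \<in> ?K" for k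
  proof (rule ccontr)
    assume "\<not> 0 \<le> h \<bullet> k"
    then have neg: "h \<bullet> k < 0" by simp
    then have "(\<beta> / (h \<bullet> k)) *\<^sub>R k \<in> ?K"
      using k \<beta> by (intro convex_cone_hull_mul) (auto simp: zero_le_divide_iff)
    from h(2)[OF this] show False using neg by simp
  qed
  obtain y \<tau> where y: "h = (y, \<tau>)" by force
  have \<tau>: "\<tau> < 0" using h(1) \<beta> y by simp
  have "b i \<le> a i \<bullet> ((- 1 / \<tau>) *\<^sub>R y)" if "i \<in> I" for i
  proof -
    have "0 \<le> y \<bullet> a i + \<tau> * b i"
      using nonneg[OF hull_inc[of "(a i, b i)"]] that y by auto
    then show ?thesis using \<tau> by (simp add: inner_commute field_simps)
  qed
  then show thesis by (rule that(1))
qed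

section \<open>Faces and edges of polytopes\<close>

lemma convex_hull_subset_halfspace_le:
  "S \<subseteq> {z. g \<bullet> z \<le> c} \<Longrightarrow> convex hull S \<subseteq> {z. g \<bullet> z \<le> c}"
  by (simp add: hull_minimal convex_halfspace_le)

text \<open>Take a face of least dimension through \<open>q\<close>. If \<open>q\<close> were on its
  relative boundary, it would lie in a facet of it, which is a face of \<open>P\<close> of smaller
  dimension.\<close>

lemma polytope_minimal_face:
  fixes P :: "'a::euclidean_space set"
  assumes "polytope P" "q \<in> P"
  obtains F where "F face_of P" "q \<in> rel_interior F"
proof -
  let ?Q = "\<lambda>F. F face_of P \<and> q \<in> F"
  have "?Q P" using assms polytope_imp_convex face_of_refl by blast
  \<comment> \<open>\<open>aff_dim\<close> is an integer and at least -1; adding 1 gives a natural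
    number to minimise.\<close>
  then obtain F where F: "?Q F" and min: "\<And>G. ?Q G \<Longrightarrow> nat (aff_dim F + 1) \<le> nat (aff_dim G + 1)"
    using ex_has_least_nat[of ?Q P "\<lambda>F. nat (aff_dim F + 1)"] by blast
  have "polytope F" using F assms(1) face_of_polytope_polytope by blast
  then have poly: "polyhedron F" by (rule polytope_imp_polyhedron)
  have "q \<in> rel_interior F"
  proof (rule ccontr)
    assume "q \<notin> rel_interior F"
    then obtain G where G: "G facet_of F" "q \<in> G"
      using F rel_interior_of_polyhedron[OF poly] by auto
    then have GQ: "?Q G" using F face_of_trans facet_of_imp_face_of by blast
    have "aff_dim G = aff_dim F - 1" "G \<noteq> {}" using G facet_of_def by blast+
    then have "nat (aff_dim G + 1) < nat (aff_dim F + 1)" using aff_dim_geq[of F]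
      aff_dim_geq[of G] by linarith
    with min[OF GQ] show False by simp
  qed
  then show thesis using F that by metis
qed

text \<open>Let \<open>F\<close> be the face with \<open>q\<close> in its relative interior. Were
  its dimension at least 2, the hyperplane would cut it in a set of dimension at least 1, and
  \<open>q\<close> would be the midpoint of a segment in the section.\<close>

lemma extreme_point_of_hyperplane_section:
  fixes P :: "'a::euclidean_space set"
  assumes P: "polytope P" and q: "q extreme_point_of (P \<inter> {z. h \<bullet> z = \<alpha>})"
  obtains F where "F face_of P" "q \<in> F" "aff_dim F \<le> 1"
proof -
  have qP: "q \<in> P" "h \<bullet> q = \<alpha>" using q by (auto simp: extreme_point_of_def)
  obtain F where F: "F face_of P" "q \<in> rel_interior F" using polytope_minimal_face[OF P qP(1)] .
  have "aff_dim F \<le> 1"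
  proof (rule ccontr)
    assume *: "\<not> aff_dim F \<le> 1"
    let ?A = "affine hull F \<inter> {z. h \<bullet> z = \<alpha>}"
    have qF: "q \<in> affine hull F" using F(2) rel_interior_subset by (blast intro: hull_inc)
    have "aff_dim ?A \<ge> 1"
      using aff_dim_affine_Int_hyperplane[of "affine hull F" h \<alpha>] * qF qP(2)
      by (auto split: if_splits)
    then obtain z where z: "z \<in> ?A" "z \<noteq> q"
      using aff_dim_subset[of ?A "{q}"] by fastforce
    obtain e where e: "e > 0" "cball q e \<inter> affine hull F \<subseteq> F"
      using F(2) by (auto simp: mem_rel_interior_cball)
    define d where "d = (e / norm (z - q)) *\<^sub>R (z - q)"
    have aff: "q + t *\<^sub>R (z - q) \<in> ?A" for t
      using z(1) qF qP(2) mem_affine[OF affine_affine_hull[of F], of q z "1 - t" t]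
      by (auto simp: algebra_simps)
    have nd: "norm d = e" "d \<noteq> 0" using z e unfolding d_def by auto
    have "q + d \<in> ?A" "q - d \<in> ?A"
      using aff[of "e / norm (z - q)"] aff[of "- e / norm (z - q)"] unfolding d_def by auto
    moreover have "q + d \<in> cball q e" "q - d \<in> cball q e" using nd by (simp_all add: dist_norm)
    ultimately have "q + d \<in> P \<inter> {z. h \<bullet> z = \<alpha>}" "q - d \<in> P \<inter> {z. h \<bullet> z = \<alpha>}"
      using e(2) face_of_imp_subset[OF F(1)] by blast+
    moreover have "q \<in> open_segment (q + d) (q - d)"
    proof -
      have "midpoint (q + d) (q - d) = q" by (simp add: midpoint_eq_iff)
      moreover have "q + d \<noteq> q - d" using nd(2) by (simp add: eq_neg_iff_add_eq_0 flip: scaleR_2)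
      ultimately show ?thesis by (metis midpoint_in_open_segment)
    qed
    ultimately show False using q by (auto simp: extreme_point_of_def)
  qed
  moreover have "q \<in> F" using F(2) rel_interior_subset by blast
  ultimately show thesis using F(1) that by metis
qed

text \<open>A hyperplane separating \<open>v\<close> from the other vertices cuts out the vertex figure of
  \<open>v\<close>; the vertices of this section are its intersections with the edges at \<open>v\<close>.\<close>

lemma polytope_improving_edge:
  fixes P :: "'a::euclidean_space set"
  assumes P: "polytope P" and v: "v extreme_point_of P" and y: "y \<in> P" "g \<bullet> v < g \<bullet> y"
  obtains e w where "e edge_of P" "v \<in> e" "w \<in> e" "w extreme_point_of P" "g \<bullet> v < g \<bullet> w"
proof -
  let ?E = "{u. u extreme_point_of P}"
  have finE: "finite ?E" using finite_polyhedron_extreme_points polytope_imp_polyhedron[OF P] by blast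
  have KM: "P = convex hull ?E"
    using Krein_Milman_Minkowski[OF polytope_imp_compact[OF P] polytope_imp_convex[OF P]] .
  have "v \<notin> convex hull (?E - {v})"
  proof
    assume *: "v \<in> convex hull (?E - {v})"
    have "convex hull (?E - {v}) \<subseteq> convex hull ?E" by (rule hull_mono) blast
    then have "convex hull (?E - {v}) \<subseteq> P" by (simp only: KM[symmetric])
    then have "v extreme_point_of (convex hull (?E - {v}))"
      using v * unfolding extreme_point_of_def by blast
    then show False using extreme_point_of_convex_hull by blast
  qed
  moreover have "closed (convex hull (?E - {v}))"
    using finE by (simp add: compact_imp_closed compact_convex_hull finite_imp_compact)
  ultimately obtain h \<alpha> where h: "h \<bullet> v < \<alpha>" "\<And>z. z \<in> convex hull (?E - {v}) \<Longrightarrow> \<alpha> < h \<bullet> z"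
    using separating_hyperplane_closed_point[OF convex_convex_hull] by blast
  have hE: "\<alpha> < h \<bullet> u" if "u \<in> ?E" "u \<noteq> v" for u
    using h(2)[OF hull_inc] that by blast
  obtain u where u: "u \<in> ?E" "g \<bullet> v < g \<bullet> u"
  proof (rule ccontr)
    assume "\<not> thesis"
    then have "?E \<subseteq> {z. g \<bullet> z \<le> g \<bullet> v}" using that by force
    then have "P \<subseteq> {z. g \<bullet> z \<le> g \<bullet> v}"
      using convex_hull_subset_halfspace_le KM by metis
    then show False using y by auto
  qed
  then have hu: "\<alpha> < h \<bullet> u" using hE by blast
  let ?Q = "P \<inter> {z. h \<bullet> z = \<alpha>}"
  \<comment> \<open>The segment from \<open>v\<close> to the better vertex \<open>u\<close> meets
    the hyperplane at parameter \<open>\<theta>\<close>; the meeting point \<open>z\<close> keeps a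
    positive share of the gain in \<open>g\<close>.\<close>
  define \<theta> where "\<theta> = (\<alpha> - h \<bullet> v) / (h \<bullet> u - h \<bullet> v)"
  have \<theta>: "0 < \<theta>" "\<theta> \<le> 1" using hu h(1) by (auto simp: \<theta>_def)
  define z where "z = (1 - \<theta>) *\<^sub>R v + \<theta> *\<^sub>R u"
  have "z \<in> P" unfolding z_def
    using \<theta> u v polytope_imp_convex[OF P] by (intro convexD_alt) (auto simp: extreme_point_of_def)
  moreover have "h \<bullet> z = h \<bullet> v + \<theta> * (h \<bullet> u - h \<bullet> v)"
    unfolding z_def by (simp add: algebra_simps)
  then have "h \<bullet> z = \<alpha>" using hu h(1) by (simp add: \<theta>_def)
  ultimately have zQ: "z \<in> ?Q" by simp
  have "g \<bullet> z - g \<bullet> v = \<theta> * (g \<bullet> u - g \<bullet> v)" unfolding z_def by (simp add: algebra_simps)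
  then have gz: "g \<bullet> v < g \<bullet> z" using \<theta> u(2) by (smt (verit) mult_pos_pos)
  have Q: "polytope ?Q" using P polytope_Int_polyhedron polyhedron_hyperplane by blast
  obtain q where q: "q extreme_point_of ?Q" "g \<bullet> v < g \<bullet> q"
  proof (rule ccontr)
    assume "\<not> thesis"
    then have "{q. q extreme_point_of ?Q} \<subseteq> {z. g \<bullet> z \<le> g \<bullet> v}" using that by force
    then have "?Q \<subseteq> {z. g \<bullet> z \<le> g \<bullet> v}"
      using convex_hull_subset_halfspace_le
        Krein_Milman_Minkowski[OF polytope_imp_compact[OF Q] polytope_imp_convex[OF Q]] by metis
    then show False using zQ gz by auto
  qed
  obtain F where F: "F face_of P" "q \<in> F" "aff_dim F \<le> 1"
    using extreme_point_of_hyperplane_section[OF P q(1)] .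
  have hq: "h \<bullet> q = \<alpha>" using q(1) by (simp add: extreme_point_of_def)
  have polyF: "polytope F" using F P face_of_polytope_polytope by blast
  let ?EF = "{w. w extreme_point_of F}"
  have KMF: "F = convex hull ?EF"
    using Krein_Milman_Minkowski[OF polytope_imp_compact[OF polyF] polytope_imp_convex[OF polyF]] .
  have EF: "w extreme_point_of P" if "w \<in> ?EF" for w
    using that extreme_point_of_face[OF F(1)] by blast
  \<comment> \<open>Otherwise all vertices of \<open>F\<close> lie strictly beyond the hyperplane,
    although \<open>q\<close> in \<open>F\<close> lies on it.\<close>
  have vF: "v \<in> F"
  proof (rule ccontr)
    assume "v \<notin> F"
    then have "?EF \<subseteq> ?E - {v}" using EF by (auto simp: extreme_point_of_def)
    then have "convex hull ?EF \<subseteq> convex hull (?E - {v})" by (rule hull_mono)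
    then have "q \<in> convex hull (?E - {v})" using F(2) KMF by (metis (lifting) subsetD)
    then show False using h(2) hq by fastforce
  qed
  obtain w where w: "w \<in> ?EF" "g \<bullet> v < g \<bullet> w"
  proof (rule ccontr)
    assume "\<not> thesis"
    then have "?EF \<subseteq> {z. g \<bullet> z \<le> g \<bullet> v}" using that by force
    then have "F \<subseteq> {z. g \<bullet> z \<le> g \<bullet> v}"
      using convex_hull_subset_halfspace_le KMF by metis
    then show False using F(2) q(2) by auto
  qed
  have wF: "w \<in> F" using w by (simp add: extreme_point_of_def)
  have "aff_dim {v, w} = 1" using w(2) aff_dim_2[of v w] by auto
  then have "aff_dim F = 1" using F(3) aff_dim_subset[of "{v, w}" F] vF wF by simp
  then have "F edge_of P" using F(1) by (simp add: edge_of_def)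
  then show thesis using that[OF _ vF wF EF[OF w(1)] w(2)] by simp
qed

text \<open>Feasibility test for a small step: \<open>p\<close> is the slack of a constraint and
  \<open>q\<close> its rate of change, whose sign matters only if the constraint is tight.\<close>

lemma eventually_affine_nonneg:
  fixes p q :: real
  assumes "0 \<le> p" "p = 0 \<Longrightarrow> 0 \<le> q"
  shows "\<forall>\<^sub>F t in at_right 0. 0 \<le> p + t * q"
proof (cases "p = 0")
  case True
  then show ?thesis using assms(2)
    by (intro eventually_mono[OF eventually_at_right_less[of 0]]) simp
next
  case False
  have "((\<lambda>t. p + t * q) \<longlongrightarrow> p + 0 * q) (at_right 0)" by (intro tendsto_intros)
  then have "((\<lambda>t. p + t * q) \<longlongrightarrow> p) (at_right 0)" by simp
  then have "\<forall>\<^sub>F t in at_right 0. 0 < p + t * q" using False assms(1) by (intro order_tendstoD(1)) auto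
  then show ?thesis by (rule eventually_mono) simp
qed

text \<open>A threshold \<open>\<tau>\<close> lies above \<open>g\<close> where \<open>f\<close> is
  positive and below \<open>g\<close> where \<open>f\<close> is negative. As \<open>f\<close> sums
  to 0, replacing \<open>g\<close> by \<open>g - \<tau>\<close> keeps the sum and makes every term
  nonpositive.\<close>

lemma sum_mult_nonpos_of_threshold:
  fixes f g :: "'a \<Rightarrow> real"
  assumes fin: "finite A" and zero: "(\<Sum>i\<in>A. f i) = 0"
    and thr: "\<And>i l. i \<in> A \<Longrightarrow> l \<in> A \<Longrightarrow> 0 < f i \<Longrightarrow> f l < 0 \<Longrightarrow> g i \<le> g l"
  shows "(\<Sum>i\<in>A. g i * f i) \<le> 0"
proof -
  let ?G = "g ` {i \<in> A. 0 < f i}"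
  have "\<exists>\<tau>. (\<forall>i\<in>A. 0 < f i \<longrightarrow> g i \<le> \<tau>) \<and> (\<forall>i\<in>A. f i < 0 \<longrightarrow> \<tau> \<le> g i)"
  proof (cases "{i \<in> A. 0 < f i} = {}")
    case True
    \<comment> \<open>Any lower bound of \<open>g\<close> will do here. The element 0 is inserted so
      that the minimum exists even for empty \<open>A\<close>.\<close>
    let ?L = "insert 0 (g ` A)"
    have "\<forall>i\<in>A. Min ?L \<le> g i" using fin by simp
    then show ?thesis using True by (intro exI[of _ "Min ?L"]) blast
  next
    case False
    have finG: "finite ?G" using fin by simp
    have "\<forall>i\<in>A. 0 < f i \<longrightarrow> g i \<le> Max ?G" using finG by (auto intro: Max_ge)
    moreover have "\<forall>i\<in>A. f i < 0 \<longrightarrow> Max ?G \<le> g i"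
      using finG False thr by (auto simp: Max_le_iff)
    ultimately show ?thesis by blast
  qed
  then obtain \<tau> where \<tau>: "\<forall>i\<in>A. 0 < f i \<longrightarrow> g i \<le> \<tau>" "\<forall>i\<in>A. f i < 0 \<longrightarrow> \<tau> \<le> g i" by blast
  have "(\<Sum>i\<in>A. g i * f i) = (\<Sum>i\<in>A. (g i - \<tau>) * f i) + \<tau> * (\<Sum>i\<in>A. f i)"
    by (simp add: sum_distrib_left algebra_simps sum_subtractf sum.distrib)
  also have "\<dots> = (\<Sum>i\<in>A. (g i - \<tau>) * f i)" by (simp add: zero)
  also have "\<dots> \<le> 0"
  proof (rule sum_nonpos)
    fix i assume "i \<in> A"
    then show "(g i - \<tau>) * f i \<le> 0" using \<tau>
      by (cases "f i" "0::real" rule: linorder_cases) (auto simp: mult_le_0_iff)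
  qed
  finally show ?thesis .
qed

section \<open>The transportation polytope\<close>

definition cluster_size :: "real^'n::finite^'k::finite \<Rightarrow> 'k \<Rightarrow> real" where
  "cluster_size y i = (\<Sum>j\<in>UNIV. y $ i $ j)"

lemma cluster_size_linear:
  "cluster_size (y + z) i = cluster_size y i + cluster_size z i"
  "cluster_size (y - z) i = cluster_size y i - cluster_size z i"
  "cluster_size (c *\<^sub>R y) i = c * cluster_size y i"
  by (simp_all add: cluster_size_def sum.distrib sum_subtractf sum_distrib_left)

lemma transportation_polytope_iff:
  "y \<in> transportation_polytope kmin kmax \<longleftrightarrow>
     (\<forall>i j. 0 \<le> y $ i $ j) \<and> (\<forall>j. (\<Sum>i\<in>UNIV. y $ i $ j) = 1) \<and>
     (\<forall>i. real (kmin i) \<le> cluster_size y i \<and> cluster_size y i \<le> real (kmax i))"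
  by (simp add: transportation_polytope_def cluster_size_def)

lemma cluster_size_mono_strict:
  fixes a b :: "real^'n::finite^'k::finite"
  assumes "\<And>j. a $ i $ j \<le> b $ i $ j" "a $ i $ j0 + \<theta> \<le> b $ i $ j0"
  shows "cluster_size a i + \<theta> \<le> cluster_size b i"
proof -
  have "cluster_size a i + \<theta> = (\<Sum>j\<in>UNIV. a $ i $ j + (if j = j0 then \<theta> else 0))"
    by (simp add: cluster_size_def sum.distrib)
  also have "\<dots> \<le> cluster_size b i"
    unfolding cluster_size_def using assms by (intro sum_mono) auto
  finally show ?thesis .
qed

section \<open>Clusterings as the 0/1 points of the transportation polytope\<close>

locale bounded_clusterings =
  fixes x :: "'n::finite \<Rightarrow> real^'d"
    and kmin kmax :: "'k::finite \<Rightarrow> nat"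
  assumes inj_x: "inj x"
begin

abbreviation T :: "(real^'n^'k) set" where
  "T \<equiv> transportation_polytope kmin kmax"

abbreviation ind :: "('k \<Rightarrow> (real^'d) set) \<Rightarrow> real^'n^'k" where
  "ind \<equiv> indicator_vector x"

definition feasible :: "('k \<Rightarrow> (real^'d) set) \<Rightarrow> bool" where
  "feasible C \<longleftrightarrow> clustering (range x) C \<and> within_bounds kmin kmax C"

lemma ind_nth: "ind C $ i $ j = (if x j \<in> C i then 1 else 0)"
  by (simp add: indicator_vector_def)

lemma clustering_obtain:
  assumes "clustering (range x) C"
  obtains i where "x j \<in> C i" "\<And>l. x j \<in> C l \<longleftrightarrow> l = i"
proof -
  have "x j \<in> (\<Union>i. C i)" using assms by (simp add: clustering_def)
  then obtain i where i: "x j \<in> C i" by blast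
  moreover have "l = i" if "x j \<in> C l" for l
    using assms i that unfolding clustering_def by (metis disjoint_iff)
  ultimately show thesis using that by metis
qed

lemma clustering_unique:
  assumes "clustering (range x) C" "z \<in> C i" "z \<in> C l"
  shows "i = l"
  using assms unfolding clustering_def by (metis disjoint_iff)

lemma clustering_mem_range:
  assumes "clustering (range x) C" "z \<in> C i"
  obtains j where "z = x j"
  using assms unfolding clustering_def by blast

lemma sum_ind_clusters:
  assumes "clustering (range x) C"
  shows "(\<Sum>i\<in>UNIV. ind C $ i $ j) = 1"
proof -
  obtain i where "\<And>l. x j \<in> C l \<longleftrightarrow> l = i" 
    using clustering_obtain[OF assms, where j = j] by metis
  then show ?thesis by (simp add: ind_nth)
qed

lemma ind_other:
  assumes C: "feasible C" and "x j \<in> C i" "m \<noteq> i"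
  shows "ind C $ m $ j = 0"
proof -
  have "x j \<notin> C m" using assms C clustering_unique[of C "x j" i m] unfolding feasible_def by metis
  then show ?thesis by (simp add: ind_nth)
qed

lemma cluster_size_ind:
  assumes "clustering (range x) C"
  shows "cluster_size (ind C) i = real (card (C i))"
proof -
  have "C i \<subseteq> range x" using assms by (auto simp: clustering_def)
  then have "C i = x ` {j. x j \<in> C i}" by auto
  then have "card (C i) = card {j. x j \<in> C i}"
    using card_image[OF inj_on_subset[OF inj_x], of "{j. x j \<in> C i}"] by simp
  then show ?thesis by (simp add: cluster_size_def ind_nth sum.If_cases)
qed

lemma ind_in_T: "feasible C \<Longrightarrow> ind C \<in> T"
  by (auto simp: transportation_polytope_iff feasible_def sum_ind_clusters cluster_size_ind
      within_bounds_def) (auto simp: ind_nth)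

lemma ind_eq_iff:
  assumes "feasible C" "feasible D"
  shows "ind C = ind D \<longleftrightarrow> C = D"
proof
  assume eq: "ind C = ind D"
  have "z \<in> C i \<longleftrightarrow> z \<in> D i" for z i
  proof (cases "z \<in> range x")
    case True
    then obtain j where "z = x j" by blast
    moreover have "ind C $ i $ j = ind D $ i $ j" using eq by simp
    ultimately show ?thesis by (simp add: ind_nth split: if_splits)
  next
    case False
    then show ?thesis using assms by (auto simp: feasible_def clustering_def)
  qed
  then show "C = D" by blast
qed simp

lemma T_nonneg: "y \<in> T \<Longrightarrow> 0 \<le> y $ i $ j"
  by (simp add: transportation_polytope_iff)

lemma T_sum: "y \<in> T \<Longrightarrow> (\<Sum>i\<in>UNIV. y $ i $ j) = 1"
  by (simp add: transportation_polytope_iff)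

lemma T_add_le_one:
  assumes "y \<in> T" "i \<noteq> l"
  shows "y $ i $ j + y $ l $ j \<le> 1"
proof -
  have "(\<Sum>m\<in>{i, l}. y $ m $ j) \<le> (\<Sum>m\<in>UNIV. y $ m $ j)"
    using assms by (intro sum_mono2) (auto simp: T_nonneg)
  then show ?thesis using assms by (simp add: T_sum)
qed

lemma T_le_one: "y \<in> T \<Longrightarrow> y $ i $ j \<le> 1"
  using member_le_sum[of i UNIV "\<lambda>i. y $ i $ j"] by (simp add: T_nonneg T_sum)

lemma T_entry_one:
  assumes "y \<in> T" "\<And>l. l \<noteq> i \<Longrightarrow> y $ l $ j = 0"
  shows "y $ i $ j = 1"
proof -
  have "(\<Sum>l\<in>UNIV. y $ l $ j) = (\<Sum>l\<in>{i}. y $ l $ j)"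
    using assms(2) by (intro sum.mono_neutral_right) auto
  then show ?thesis using T_sum[OF assms(1)] by simp
qed

lemma integral_in_T:
  assumes y: "y \<in> T" and int: "\<And>i j. y $ i $ j = 0 \<or> y $ i $ j = 1"
  obtains C where "feasible C" "ind C = y"
proof -
  define C where "C i = x ` {j. y $ i $ j = 1}" for i
  have mem: "x j \<in> C i \<longleftrightarrow> y $ i $ j = 1" for i j
    using inj_x by (auto simp: C_def inj_eq)
  have ind: "ind C = y"
    using int by (auto simp: vec_eq_iff ind_nth mem)
  have "\<exists>i. x j \<in> C i" for j
  proof (rule ccontr)
    assume "\<not> ?thesis"
    then have "\<And>i. y $ i $ j = 0" using int mem by blast
    then show False using T_sum[OF y, of j] by simp
  qed
  moreover have "C i \<inter> C l = {}" if "i \<noteq> l" for i l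
  proof -
    have "\<not> (y $ i $ j = 1 \<and> y $ l $ j = 1)" for j
      using T_add_le_one[OF y that, of j] by auto
    then have "\<not> (x j \<in> C i \<and> x j \<in> C l)" for j using mem by blast
    then show ?thesis by (auto simp: C_def)
  qed
  ultimately have cl: "clustering (range x) C"
    unfolding clustering_def by (auto simp: C_def)
  have "within_bounds kmin kmax C"
    using y cluster_size_ind[OF cl] ind by (simp add: within_bounds_def transportation_polytope_iff)
  then show thesis using that cl ind feasible_def by blast
qed

section \<open>Exchange vectors and exchange digraphs\<close>

definition exchange_vector :: "('k \<times> 'k \<times> (real^'d)) set \<Rightarrow> real^'n^'k" where
  "exchange_vector A =
     (\<chi> m j. \<Sum>(i, l, z)\<in>A. if z = x j then of_bool (m = l) - of_bool (m = i) else 0)"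

text \<open>This extends the clustering difference graph to fractional \<open>y\<close>, so that one
  path argument serves both for the integrality of the polytope and for its edges.\<close>

definition exchange_digraph ::
  "('k \<Rightarrow> (real^'d) set) \<Rightarrow> real^'n^'k \<Rightarrow> ('k, 'k \<times> 'k \<times> (real^'d)) pre_digraph" where
  "exchange_digraph C y = \<lparr> verts = UNIV,
     arcs = {(i, l, z). i \<noteq> l \<and> z \<in> C i \<and> (\<exists>j. z = x j \<and> 0 < y $ l $ j)},
     tail = (\<lambda>(i, l, z). i),
     head = (\<lambda>(i, l, z). l) \<rparr>"

lemma exchange_digraph_simps [simp]:
  "verts (exchange_digraph C y) = UNIV"
  "(i, l, z) \<in> arcs (exchange_digraph C y) \<longleftrightarrow>
     i \<noteq> l \<and> z \<in> C i \<and> (\<exists>j. z = x j \<and> 0 < y $ l $ j)"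
  "tail (exchange_digraph C y) e = fst e"
  "head (exchange_digraph C y) e = fst (snd e)"
  by (auto simp: exchange_digraph_def split: prod.splits)

lemma fin_digraph_exchange: "fin_digraph (exchange_digraph C y)"
proof
  have "arcs (exchange_digraph C y) \<subseteq> UNIV \<times> UNIV \<times> range x"
    by (auto simp: exchange_digraph_def)
  then show "finite (arcs (exchange_digraph C y))"
    by (rule finite_subset) simp
qed simp_all

lemma exchange_digraph_ind:
  assumes "feasible C" "feasible D"
  shows "exchange_digraph C (ind D) = CDG C D"
proof -
  have "(\<exists>j. z = x j \<and> 0 < ind D $ l $ j) \<longleftrightarrow> z \<in> D l" for z l
    using assms(2) unfolding feasible_def
    by (auto simp: ind_nth elim: clustering_mem_range split: if_splits)
  then show ?thesis by (auto simp: exchange_digraph_def CDG_def)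
qed

subsection \<open>Exchanges\<close>

text \<open>Clusters are disjoint, so an item determines the tail of its arc. Since tails are
  distinct on \<open>A\<close>, only one arc carries the item and the sum reduces to one
  term.\<close>

lemma exchange_vector_nth_arc:
  assumes C: "feasible C" and A: "A \<subseteq> arcs (exchange_digraph C y)" "inj_on fst A" and a: "(i, l, x j) \<in> A"
  shows "exchange_vector A $ m $ j = of_bool (m = l) - of_bool (m = i)"
proof -
  have "A \<subseteq> UNIV \<times> UNIV \<times> range x" using A(1) by (auto simp: exchange_digraph_def)
  then have fin: "finite A" by (rule finite_subset) simp
  have uniq: "e = (i, l, x j)" if "e \<in> A" "snd (snd e) = x j" for e
  proof -
    obtain i' l' where e: "e = (i', l', x j)" using \<open>snd (snd e) = x j\<close> by (metis prod.collapse)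
    have "x j \<in> C i'" "x j \<in> C i" using A(1) a that(1) e by auto
    then have "i' = i" using C clustering_unique[of C "x j" i' i] by (simp add: feasible_def)
    then show ?thesis by (intro inj_onD[OF A(2) _ that(1) a]) (simp add: e)
  qed
  have "(case e of (i, l, z) \<Rightarrow> if z = x j then of_bool (m = l) - of_bool (m = i) else 0) =
      (if e = (i, l, x j) then of_bool (m = l) - of_bool (m = i) else (0::real))" if "e \<in> A" for e
  proof (cases "snd (snd e) = x j")
    case True
    then have "e = (i, l, x j)" by (rule uniq[OF that])
    then show ?thesis by simp
  qed (auto simp: case_prod_beta)
  then have "exchange_vector A $ m $ j =
      (\<Sum>e\<in>A. if e = (i, l, x j) then of_bool (m = l) - of_bool (m = i) else 0)"
    unfolding exchange_vector_def by (simp cong: sum.cong)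
  then show ?thesis using fin a by simp
qed

lemma exchange_vector_nth_no_arc:
  assumes "\<And>i l. (i, l, x j) \<notin> A"
  shows "exchange_vector A $ m $ j = 0"
  unfolding exchange_vector_def using assms by (auto intro!: sum.neutral)

lemma sum_exchange_vector:
  assumes C: "feasible C" and A: "A \<subseteq> arcs (exchange_digraph C y)" "inj_on fst A"
  shows "(\<Sum>i\<in>UNIV. exchange_vector A $ i $ j) = 0"
proof (cases "\<exists>i l. (i, l, x j) \<in> A")
  case True
  then obtain i l where "(i, l, x j) \<in> A" by blast
  then show ?thesis by (simp add: exchange_vector_nth_arc[OF C A] sum_subtractf of_bool_def)
next
  case False
  then show ?thesis using exchange_vector_nth_no_arc by simp
qed

lemma cluster_size_exchange_vector:
  assumes A: "A \<subseteq> arcs (exchange_digraph C y)"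
  shows "cluster_size (exchange_vector A) m = (\<Sum>e\<in>A. of_bool (m = fst (snd e)) - of_bool (m = fst e))"
proof -
  have "(\<Sum>j\<in>UNIV. if z = x j then c else 0) = c" if z: "z \<in> range x" for z and c :: real
  proof -
    obtain j where "z = x j" using z by blast
    then have "(\<Sum>j\<in>UNIV. if z = x j then c else 0) = (\<Sum>i\<in>UNIV. if i = j then c else 0)"
      using inj_x by (intro sum.cong) (auto simp: inj_eq)
    then show ?thesis by simp
  qed
  moreover have "snd (snd e) \<in> range x" if "e \<in> A" for e
    using subsetD[OF A that] by (cases e) auto
  ultimately have *: "(\<Sum>j\<in>UNIV. if snd (snd e) = x j then c else 0) = c" if "e \<in> A" for e and c :: real
    using that by blast
  show ?thesis
    unfolding cluster_size_def exchange_vector_def case_prod_beta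
    by (simp add: sum.swap[of _ A] * cong: if_cong)
qed

text \<open>Sizes telescope along the walk: only the end nodes change, and for a closed walk none
  does.\<close>

lemma exchange_vector_awalk:
  assumes walk: "pre_digraph.awalk (exchange_digraph C y) u p v" and tails: "distinct (map fst p)"
  shows "set p \<subseteq> arcs (exchange_digraph C y)" "inj_on fst (set p)"
    "cluster_size (exchange_vector (set p)) m = of_bool (m = v) - of_bool (m = u)"
proof -
  interpret G: fin_digraph "exchange_digraph C y" by (rule fin_digraph_exchange)
  show A: "set p \<subseteq> arcs (exchange_digraph C y)" using walk unfolding G.awalk_def by simp
  show "inj_on fst (set p)" using tails by (simp add: distinct_map)
  have "(\<Sum>e\<in>set p. of_bool (m = fst (snd e)) - of_bool (m = fst e)) =
      (\<Sum>e\<leftarrow>p. of_bool (m = fst (snd e)) - of_bool (m = fst e) :: real)"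
    using tails by (simp add: sum_list_distinct_conv_sum_set distinct_map)
  then show "cluster_size (exchange_vector (set p)) m = of_bool (m = v) - of_bool (m = u)"
    using G.sum_list_awalk_telescope[OF walk, of "\<lambda>i. of_bool (m = i)"]
      cluster_size_exchange_vector[OF A] by simp
qed

context
  fixes C :: "'k \<Rightarrow> (real^'d) set" and y :: "real^'n^'k"
  assumes C: "feasible C" and y: "y \<in> T"
begin

lemma ind_add_exchange_vector_nth:
  assumes A: "A \<subseteq> arcs (exchange_digraph C y)" "inj_on fst A"
  shows "(ind C + exchange_vector A) $ m $ j = 0 \<or> (ind C + exchange_vector A) $ m $ j = 1"
proof (cases "\<exists>i l. (i, l, x j) \<in> A")
  case True
  then obtain i l where a: "(i, l, x j) \<in> A" by blast
  then have "(i, l, x j) \<in> arcs (exchange_digraph C y)" using A(1) by (rule rev_subsetD)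
  then have "x j \<in> C i" "i \<noteq> l" by simp_all
  then show ?thesis using ind_other[OF C, of j i m] exchange_vector_nth_arc[OF C A a]
    by (cases "m = i") (auto simp: ind_nth)
next
  case False
  then have "exchange_vector A $ m $ j = 0" by (intro exchange_vector_nth_no_arc) simp
  then show ?thesis by (simp add: ind_nth)
qed

text \<open>Entries fall only at the heads of arcs, where \<open>y\<close> has at least
  \<open>\<theta>\<close> to give.\<close>

lemma exchange_step_entry_nonneg:
  assumes A: "A \<subseteq> arcs (exchange_digraph C y)" "inj_on fst A"
    and \<theta>: "0 \<le> \<theta>" "\<And>i l j. (i, l, x j) \<in> A \<Longrightarrow> \<theta> \<le> y $ l $ j"
  shows "0 \<le> (y - \<theta> *\<^sub>R exchange_vector A) $ m $ j"
proof (cases "\<exists>i l. (i, l, x j) \<in> A")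
  case True
  then obtain i l where a: "(i, l, x j) \<in> A" by blast
  show ?thesis
    using exchange_vector_nth_arc[OF C A a] \<theta>(1) \<theta>(2)[OF a] T_nonneg[OF y, of m j] by auto
next
  case False
  then have "exchange_vector A $ m $ j = 0" by (intro exchange_vector_nth_no_arc) simp
  then show ?thesis by (simp add: T_nonneg[OF y])
qed

text \<open>An item outside \<open>C u\<close> of which \<open>y\<close> gives \<open>u\<close> a
  fraction would be the label of an arc into \<open>u\<close>.\<close>

lemma no_arc_into_le:
  assumes "\<And>e. e \<in> arcs (exchange_digraph C y) \<Longrightarrow> fst (snd e) \<noteq> u"
  shows "y $ u $ j \<le> ind C $ u $ j"
proof (cases "x j \<in> C u")
  case True
  then show ?thesis using T_le_one[OF y] by (simp add: ind_nth)
next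
  case False
  obtain i where i: "x j \<in> C i" using clustering_obtain C feasible_def by metis
  have "\<not> 0 < y $ u $ j"
  proof
    assume "0 < y $ u $ j"
    then have "(i, u, x j) \<in> arcs (exchange_digraph C y)" using i False by auto
    then show False using assms by force
  qed
  then show ?thesis by (simp add: ind_nth)
qed

text \<open>An item of \<open>C v\<close> that \<open>y\<close> gives partly to another cluster
  would label an arc out of \<open>v\<close>; hence \<open>y\<close> leaves it wholly in
  \<open>v\<close>.\<close>

lemma no_arc_from_ge:
  assumes "\<And>e. e \<in> arcs (exchange_digraph C y) \<Longrightarrow> fst e \<noteq> v"
  shows "ind C $ v $ j \<le> y $ v $ j"
proof (cases "x j \<in> C v")
  case True
  have "y $ l $ j = 0" if "l \<noteq> v" for l
  proof (rule ccontr)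
    assume "y $ l $ j \<noteq> 0"
    then have "0 < y $ l $ j" using T_nonneg[OF y, of l j] by simp
    then have "(v, l, x j) \<in> arcs (exchange_digraph C y)" using True that by auto
    then show False using assms by force
  qed
  then show ?thesis using T_entry_one[OF y, of v j] by (simp add: ind_nth)
next
  case False
  then show ?thesis using T_nonneg[OF y] by (simp add: ind_nth)
qed

text \<open>Only the size bounds at the ends of a path are at stake. The source is larger in
  \<open>C\<close> than in \<open>y\<close> and the sink is smaller, each by at least
  \<open>\<theta>\<close>; this leaves room for moving one item in \<open>C\<close> and the fraction
  \<open>\<theta>\<close> in \<open>y\<close>.\<close>

lemma exchange_in_T:
  assumes A: "A \<subseteq> arcs (exchange_digraph C y)" "inj_on fst A"
    and \<theta>: "0 < \<theta>" "\<And>i l j. (i, l, x j) \<in> A \<Longrightarrow> \<theta> \<le> y $ l $ j"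
    and size: "\<And>m. cluster_size (exchange_vector A) m = of_bool (m = v) - of_bool (m = u)"
    and uv: "u = v \<or> (\<exists>e\<in>A. fst e = u) \<and> (\<exists>e\<in>A. fst (snd e) = v) \<and>
        (\<forall>e\<in>arcs (exchange_digraph C y). fst (snd e) \<noteq> u \<and> fst e \<noteq> v)"
  shows "ind C + exchange_vector A \<in> T" "y - \<theta> *\<^sub>R exchange_vector A \<in> T"
proof -
  have bounds: "real (kmin m) \<le> cluster_size y m" "cluster_size y m \<le> real (kmax m)"
    "real (kmin m) \<le> cluster_size (ind C) m" "cluster_size (ind C) m \<le> real (kmax m)" for m
    using y ind_in_T[OF C] by (auto simp: transportation_polytope_iff)
  have ind_int: "cluster_size (ind C) m = real (card (C m))" for m
    using C by (simp add: cluster_size_ind feasible_def)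
  have arcE: "\<exists>j. e = (fst e, fst (snd e), x j) \<and> x j \<in> C (fst e) \<and> fst e \<noteq> fst (snd e)" if "e \<in> A" for e
    using subsetD[OF A(1) that] by (cases e) auto
  \<comment> \<open>An item moved out of \<open>u\<close> lies wholly in \<open>u\<close> under
    \<open>C\<close>, but \<open>y\<close> gives at least \<open>\<theta>\<close> of it elsewhere.
    No other item makes up for this, since no arc enters \<open>u\<close>.\<close>
  have u: "cluster_size y u + \<theta> \<le> cluster_size (ind C) u" if ne: "u \<noteq> v"
  proof -
    obtain e where "e \<in> A" "fst e = u" using uv ne by blast
    then obtain l j where e: "(u, l, x j) \<in> A" "x j \<in> C u" "u \<noteq> l" using arcE by metis
    have "y $ u $ j + \<theta> \<le> 1" using T_add_le_one[OF y e(3), of j] \<theta>(2)[OF e(1)] by simp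
    then have "y $ u $ j + \<theta> \<le> ind C $ u $ j" using e(2) by (simp add: ind_nth)
    moreover have "y $ u $ j \<le> ind C $ u $ j" for j using uv ne by (intro no_arc_into_le) blast
    ultimately show ?thesis by (intro cluster_size_mono_strict) auto
  qed
  have v: "cluster_size (ind C) v + \<theta> \<le> cluster_size y v" if ne: "u \<noteq> v"
  proof -
    obtain e where "e \<in> A" "fst (snd e) = v" using uv ne by blast
    then obtain i j where e: "(i, v, x j) \<in> A" "x j \<in> C i" "i \<noteq> v" using arcE by metis
    have "ind C $ v $ j + \<theta> \<le> y $ v $ j" using ind_other[OF C e(2), of v] \<theta>(2)[OF e(1)] e(3) by simp
    moreover have "ind C $ v $ j \<le> y $ v $ j" for j using uv ne by (intro no_arc_from_ge) blast
    ultimately show ?thesis by (intro cluster_size_mono_strict) auto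
  qed
  have col: "(\<Sum>i\<in>UNIV. exchange_vector A $ i $ j) = 0" for j
    by (rule sum_exchange_vector[OF C A])
  have "real (kmin m) \<le> cluster_size (y - \<theta> *\<^sub>R exchange_vector A) m \<and>
      cluster_size (y - \<theta> *\<^sub>R exchange_vector A) m \<le> real (kmax m)" for m
    using bounds[of m] u v \<theta>(1) by (cases "u = v"; cases "m = u"; cases "m = v")
      (auto simp: cluster_size_linear size)
  then show "y - \<theta> *\<^sub>R exchange_vector A \<in> T"
    using exchange_step_entry_nonneg[OF A _ \<theta>(2)] \<theta>(1) col T_sum[OF y]
    by (simp add: transportation_polytope_iff sum_subtractf sum_distrib_left[symmetric])
  \<comment> \<open>Cluster sizes and bounds are integers, so a strict inequality leaves room for a
    whole item.\<close>
  have u': "real (kmin u) + 1 \<le> cluster_size (ind C) u" if "u \<noteq> v"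
  proof -
    have "real (kmin u) < real (card (C u))" using u[OF that] bounds(1)[of u] \<theta>(1) ind_int by simp
    then show ?thesis using ind_int by simp
  qed
  have v': "cluster_size (ind C) v + 1 \<le> real (kmax v)" if "u \<noteq> v"
  proof -
    have "real (card (C v)) < real (kmax v)" using v[OF that] bounds(2)[of v] \<theta>(1) ind_int by simp
    then show ?thesis using ind_int by simp
  qed
  have "real (kmin m) \<le> cluster_size (ind C + exchange_vector A) m \<and>
      cluster_size (ind C + exchange_vector A) m \<le> real (kmax m)" for m
    using bounds[of m] u' v' by (cases "u = v"; cases "m = u"; cases "m = v")
      (auto simp: cluster_size_linear size)
  moreover have "0 \<le> (ind C + exchange_vector A) $ m $ j" for m j
    using ind_add_exchange_vector_nth[OF A, of m j] by (metis order_refl zero_le_one)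
  ultimately show "ind C + exchange_vector A \<in> T"
    using col T_sum[OF ind_in_T[OF C]]
    by (simp add: transportation_polytope_iff sum.distrib)
qed

text \<open>The step length is the least fraction that \<open>y\<close> puts at the heads of the
  arcs. It keeps \<open>y\<close> nonnegative and makes one entry vanish, which drives the induction
  over the support of \<open>y\<close>.\<close>

lemma exchange_step:
  assumes neq: "y \<noteq> ind C"
  obtains p \<theta> where
    "pre_digraph.cycle (exchange_digraph C y) p \<or>
       (\<exists>u v. p \<noteq> [] \<and> pre_digraph.apath (exchange_digraph C y) u p v)"
    "set p \<subseteq> arcs (exchange_digraph C y)" "inj_on fst (set p)"
    "0 < \<theta>" "\<exists>i l j. (i, l, x j) \<in> set p \<and> y $ l $ j = \<theta>"
    "ind C + exchange_vector (set p) \<in> T" "y - \<theta> *\<^sub>R exchange_vector (set p) \<in> T"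
proof -
  interpret G: fin_digraph "exchange_digraph C y" by (rule fin_digraph_exchange)
  have tail_eq: "tail (exchange_digraph C y) = fst" by (simp add: fun_eq_iff)
  \<comment> \<open>Without arcs every node is both a source and a sink, so the two entrywise
    comparisons force \<open>y = ind C\<close>.\<close>
  have "arcs (exchange_digraph C y) \<noteq> {}"
  proof
    assume none: "arcs (exchange_digraph C y) = {}"
    have "y $ i $ j = ind C $ i $ j" for i j
      using no_arc_into_le[of i j] no_arc_from_ge[of i j] none by fastforce
    then show False using neq by (simp add: vec_eq_iff)
  qed
  from G.cycle_or_source_sink_apath[OF this]
  obtain p u v where p: "p \<noteq> []" "G.awalk u p v" "distinct (map fst p)"
    and str: "G.cycle p \<or> (\<exists>u v. p \<noteq> [] \<and> G.apath u p v)"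
    and uv: "u = v \<or> (\<forall>e\<in>arcs (exchange_digraph C y). fst (snd e) \<noteq> u \<and> fst e \<noteq> v)"
  proof (elim disjE exE conjE)
    fix p assume cyc: "G.cycle p"
    then obtain u where "G.awalk u p u" "distinct (map (tail (exchange_digraph C y)) p)"
      by (rule G.cycle_distinct_tails)
    moreover have "p \<noteq> []" using cyc unfolding G.cycle_def by metis
    ultimately show thesis using that[of p u u] cyc by (simp add: tail_eq)
  next
    fix u p v assume *: "p \<noteq> []" "G.apath u p v"
      "\<forall>e\<in>arcs (exchange_digraph C y). head (exchange_digraph C y) e \<noteq> u \<and> tail (exchange_digraph C y) e \<noteq> v"
    have "G.awalk u p v" using *(2) unfolding G.apath_def by simp
    then show thesis using that[of p u v] * G.apath_distinct_tails[OF *(2)] by (simp add: tail_eq) metis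
  qed
  note A = exchange_vector_awalk[OF p(2,3)]
  have arcE: "\<exists>j. e = (fst e, fst (snd e), x j) \<and> 0 < y $ fst (snd e) $ j" if "e \<in> set p" for e
    using subsetD[OF A(1) that] by (cases e) auto
  define W where "W = {y $ l $ j | i l j. (i, l, x j) \<in> set p}"
  have "W \<subseteq> (\<lambda>(l, j). y $ l $ j) ` UNIV" by (auto simp: W_def)
  then have fin: "finite W" by (rule finite_subset) simp
  have WI: "y $ l $ j \<in> W" if "(i, l, x j) \<in> set p" for i l j
    using that by (auto simp: W_def)
  obtain e0 where "e0 \<in> set p" using p(1) by (cases p) auto
  then obtain j0 where "(fst e0, fst (snd e0), x j0) \<in> set p" using arcE[of e0] by metis
  then have "W \<noteq> {}" using WI by fast
  then have min: "Min W \<in> W" using fin by simp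
  have min_le: "Min W \<le> y $ l $ j" if "(i, l, x j) \<in> set p" for i l j
    using fin WI[OF that] by (rule Min_le)
  have pos: "0 < Min W"
  proof -
    obtain i l j where *: "(i, l, x j) \<in> set p" "Min W = y $ l $ j" using min unfolding W_def by blast
    then show ?thesis using arcE[OF *(1)] inj_x by (auto simp: inj_eq)
  qed
  have ends: "\<exists>e\<in>set p. fst e = u" "\<exists>e\<in>set p. fst (snd e) = v"
  proof -
    obtain e q where eq: "p = e # q" using p(1) by (cases p) auto
    then have "fst e = u" using p(2) by (simp add: G.awalk_Cons_iff)
    then show "\<exists>e\<in>set p. fst e = u" using eq by auto
    obtain e' q' where eq': "p = q' @ [e']" using p(1) by (cases p rule: rev_cases) auto
    then have "fst (snd e') = v" using p(2) by (simp add: G.awalk_Cons_iff G.awalk_Nil_iff)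
    then show "\<exists>e\<in>set p. fst (snd e) = v" using eq' by auto
  qed
  have uv': "u = v \<or> (\<exists>e\<in>set p. fst e = u) \<and> (\<exists>e\<in>set p. fst (snd e) = v) \<and>
      (\<forall>e\<in>arcs (exchange_digraph C y). fst (snd e) \<noteq> u \<and> fst e \<noteq> v)"
    using uv ends by metis
  have min': "\<exists>i l j. (i, l, x j) \<in> set p \<and> y $ l $ j = Min W"
  proof -
    obtain i l j where "(i, l, x j) \<in> set p" "Min W = y $ l $ j" using min unfolding W_def by blast
    then show ?thesis by metis
  qed
  show thesis
    by (rule that[OF str A(1,2) pos min' exchange_in_T[OF A(1,2) pos min_le A(3) uv']])
qed

end

subsection \<open>Vertices and edges\<close>

lemma finite_feasible: "finite {C. feasible C}"
proof (rule finite_subset)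
  show "{C. feasible C} \<subseteq> PiE UNIV (\<lambda>_. Pow (range x))"
    by (auto simp: feasible_def clustering_def PiE_def)
  show "finite (PiE (UNIV :: 'k set) (\<lambda>_. Pow (range x)))"
    by (intro finite_PiE) auto
qed

lemma feasible_maximizer:
  assumes "feasible C0"
  obtains C where "feasible C" "\<And>D. feasible D \<Longrightarrow> h \<bullet> ind D \<le> h \<bullet> ind C"
proof -
  let ?H = "(\<lambda>D. h \<bullet> ind D) ` {D. feasible D}"
  have fin: "finite ?H" using finite_feasible by (rule finite_imageI)
  have "?H \<noteq> {}" using assms by auto
  then have "Max ?H \<in> ?H" using fin by (intro Max_in)
  then obtain C where C: "feasible C" "Max ?H = h \<bullet> ind C" by auto
  have "h \<bullet> ind D \<le> Max ?H" if "feasible D" for D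
    using fin that by (intro Max_ge) auto
  then show thesis using that C by metis
qed

text \<open>Induction on the number of positive entries of \<open>y\<close> outside
  \<open>C\<close>. A step writes \<open>y\<close> as \<open>y'\<close> plus \<open>\<theta>\<close>
  times an exchange; adding the exchange to \<open>C\<close> gives another clustering, so
  \<open>h\<close> cannot increase along it.\<close>

lemma T_le_maximizer:
  assumes C: "feasible C" and max: "\<And>D. feasible D \<Longrightarrow> h \<bullet> ind D \<le> h \<bullet> ind C"
    and y: "y \<in> T"
  shows "h \<bullet> y \<le> h \<bullet> ind C"
proof -
  define supp where "supp z = {(l, j). 0 < z $ l $ j \<and> ind C $ l $ j = 0}" for z :: "real^'n^'k"
  show ?thesis
    using y
  proof (induction "card (supp y)" arbitrary: y rule: less_induct)
    case less
    show ?case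
    proof (cases "y = ind C")
      case False
      obtain p \<theta> where A: "set p \<subseteq> arcs (exchange_digraph C y)" "inj_on fst (set p)"
        and \<theta>: "0 < \<theta>" "\<exists>i l j. (i, l, x j) \<in> set p \<and> y $ l $ j = \<theta>"
        and T: "ind C + exchange_vector (set p) \<in> T" "y - \<theta> *\<^sub>R exchange_vector (set p) \<in> T"
        using exchange_step[OF C less.prems False] by metis
      define y' where "y' = y - \<theta> *\<^sub>R exchange_vector (set p)"
      obtain D where D: "feasible D" "ind D = ind C + exchange_vector (set p)"
        using integral_in_T[OF T(1) ind_add_exchange_vector_nth[OF C less.prems A]] .
      have "supp y' \<subseteq> supp y"
      proof -
        have "0 < y $ l $ j" if y': "0 < y' $ l $ j" and ind: "ind C $ l $ j = 0" for l j
        proof (rule ccontr)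
          assume "\<not> 0 < y $ l $ j"
          then have y0: "y $ l $ j = 0" using T_nonneg[OF less.prems, of l j] by simp
          \<comment> \<open>The exchange vector is negative only at tails, which are entries of
            \<open>C\<close>, so removing it creates no positive entry outside
            \<open>C\<close>.\<close>
          have "0 \<le> exchange_vector (set p) $ l $ j"
          proof (cases "\<exists>i m. (i, m, x j) \<in> set p")
            case True
            then obtain i m where a: "(i, m, x j) \<in> set p" by blast
            have "x j \<in> C i" using subsetD[OF A(1) a] by simp
            then have "l \<noteq> i" using ind by (auto simp: ind_nth)
            then show ?thesis by (simp add: exchange_vector_nth_arc[OF C A a])
          next
            case False
            then have "exchange_vector (set p) $ l $ j = 0"
              by (intro exchange_vector_nth_no_arc) simp
            then show ?thesis by simp
          qed
          then show False using y' y0 \<theta>(1) by (simp add: y'_def mult_less_0_iff)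
        qed
        then show ?thesis by (auto simp: supp_def)
      qed
      moreover obtain i l j where a: "(i, l, x j) \<in> set p" "y $ l $ j = \<theta>" using \<theta>(2) by metis
      have "x j \<in> C i \<and> i \<noteq> l" using subsetD[OF A(1) a(1)] by simp
      then have "(l, j) \<in> supp y" "(l, j) \<notin> supp y'"
        using \<theta>(1) a(2) ind_other[OF C, of j i l] exchange_vector_nth_arc[OF C A a(1)]
        by (auto simp: supp_def y'_def)
      ultimately have "supp y' \<subset> supp y" by blast
      then have "card (supp y') < card (supp y)" by (intro psubset_card_mono) auto
      then have "h \<bullet> y' \<le> h \<bullet> ind C" using less.hyps T(2) by (simp add: y'_def)
      moreover have "h \<bullet> exchange_vector (set p) \<le> 0"
        using max[OF D(1)] D(2) by (simp add: inner_add_right)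
      then have "\<theta> * (h \<bullet> exchange_vector (set p)) \<le> 0" using \<theta>(1) by (simp add: mult_le_0_iff)
      ultimately show ?thesis by (simp add: y'_def inner_diff_right)
    qed simp
  qed
qed

lemma convex_T: "convex T"
proof (rule convexI)
  fix a b :: "real^'n^'k" and u v :: real
  assume ab: "a \<in> T" "b \<in> T" and uv: "0 \<le> u" "0 \<le> v" "u + v = 1"
  have lower: "L \<le> u * p + v * q" if "L \<le> p" "L \<le> q" for L p q
    using uv that convex_bound_le[of "- p" "- L" "- q" u v] by auto
  have upper: "u * p + v * q \<le> U" if "p \<le> U" "q \<le> U" for U p q
    using uv that convex_bound_le[of p U q u v] by auto
  have "real (kmin i) \<le> cluster_size (u *\<^sub>R a + v *\<^sub>R b) i \<and>
      cluster_size (u *\<^sub>R a + v *\<^sub>R b) i \<le> real (kmax i)" for i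
    using ab lower[of "kmin i" "cluster_size a i" "cluster_size b i"]
      upper[of "cluster_size a i" "kmax i" "cluster_size b i"]
    by (simp add: transportation_polytope_iff cluster_size_linear)
  moreover have "(\<Sum>i\<in>UNIV. (u *\<^sub>R a + v *\<^sub>R b) $ i $ j) = 1" for j
    using T_sum[OF ab(1)] T_sum[OF ab(2)] uv(3) by (simp add: sum.distrib sum_distrib_left[symmetric])
  moreover have "0 \<le> (u *\<^sub>R a + v *\<^sub>R b) $ i $ j" for i j
    using uv T_nonneg[OF ab(1)] T_nonneg[OF ab(2)] by simp
  ultimately show "u *\<^sub>R a + v *\<^sub>R b \<in> T" unfolding transportation_polytope_iff by blast
qed

text \<open>A point of \<open>T\<close> outside the hull would be strictly separated from all
  clusterings by a linear functional, but no functional is larger on \<open>T\<close> than at its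
  best clustering.\<close>

lemma T_eq_convex_hull:
  assumes "feasible C0"
  shows "T = convex hull (ind ` {C. feasible C})"
proof
  show "convex hull (ind ` {C. feasible C}) \<subseteq> T"
    using ind_in_T by (intro hull_minimal convex_T) auto
  show "T \<subseteq> convex hull (ind ` {C. feasible C})"
  proof (rule ccontr)
    let ?H = "convex hull (ind ` {C. feasible C})"
    assume "\<not> T \<subseteq> ?H"
    then obtain y where y: "y \<in> T" "y \<notin> ?H" by blast
    have "closed ?H"
      by (intro compact_imp_closed compact_convex_hull finite_imp_compact finite_imageI finite_feasible)
    then obtain a b where ab: "a \<bullet> y < b" "\<And>z. z \<in> ?H \<Longrightarrow> b < a \<bullet> z"
      using separating_hyperplane_closed_point[OF convex_convex_hull _ y(2)] by metis
    \<comment> \<open>The hull lies on the upper side of the hyperplane; the sign is changed to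
      speak of a maximiser.\<close>
    obtain C where C: "feasible C" "\<And>D. feasible D \<Longrightarrow> - a \<bullet> ind D \<le> - a \<bullet> ind C"
      using feasible_maximizer[OF assms, of "- a"] by metis
    have "- a \<bullet> y \<le> - a \<bullet> ind C" using T_le_maximizer[OF C y(1)] .
    moreover have "b < a \<bullet> ind C" using C(1) by (intro ab(2) hull_inc) auto
    ultimately show False using ab(1) by simp
  qed
qed

lemma polytope_T:
  assumes "feasible C0"
  shows "polytope T"
  unfolding T_eq_convex_hull[OF assms]
  by (intro polytope_convex_hull finite_imageI finite_feasible)

text \<open>Every entry is 0 or 1, an end of the range of entries in \<open>T\<close>, so both ends
  of a segment through the point agree with it everywhere.\<close>

lemma ind_extreme_point:
  assumes C: "feasible C"
  shows "ind C extreme_point_of T"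
  unfolding extreme_point_of_def
proof (intro conjI ballI notI)
  show "ind C \<in> T" using C by (rule ind_in_T)
next
  fix a b assume ab: "a \<in> T" "b \<in> T" and "ind C \<in> open_segment a b"
  then obtain u where u: "0 < u" "u < 1" "ind C = (1 - u) *\<^sub>R a + u *\<^sub>R b" and "a \<noteq> b"
    by (auto simp: in_segment)
  have "a $ i $ j = b $ i $ j" for i j
  proof -
    have zero: "p = 0 \<and> q = 0" if "(1 - u) * p + u * q = 0" "0 \<le> p" "0 \<le> q" for p q
      using that u(1,2) by (simp add: add_nonneg_eq_0_iff)
    have eq: "ind C $ i $ j = (1 - u) * a $ i $ j + u * b $ i $ j" using u(3) by simp
    show ?thesis
    proof (cases "x j \<in> C i")
      case True
      then have "(1 - u) * (1 - a $ i $ j) + u * (1 - b $ i $ j) = 0"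
        using eq by (simp add: ind_nth algebra_simps)
      then have "1 - a $ i $ j = 0 \<and> 1 - b $ i $ j = 0"
        by (rule zero) (simp_all add: T_le_one ab)
      then show ?thesis by simp
    next
      case False
      then have "(1 - u) * a $ i $ j + u * b $ i $ j = 0" using eq by (simp add: ind_nth)
      then have "a $ i $ j = 0 \<and> b $ i $ j = 0" by (rule zero) (simp_all add: T_nonneg ab)
      then show ?thesis by simp
    qed
  qed
  then show False using \<open>a \<noteq> b\<close> by (simp add: vec_eq_iff)
qed

text \<open>The points of \<open>T\<close> optimal for \<open>c\<close> form a face, whose edges are
  edges of \<open>T\<close>. The secondary objective \<open>g\<close> selects an improving edge
  inside it: the move keeps optimality for \<open>c\<close> while \<open>g\<close> measures
  progress.\<close>

lemma improving_adjacent: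
  assumes C: "feasible C" and opt: "c \<in> normal_cone x kmin kmax C"
    and y: "y \<in> T" "c \<bullet> y = c \<bullet> ind C" "g \<bullet> ind C < g \<bullet> y"
  obtains D where "feasible D" "adjacent x kmin kmax C D" "c \<in> normal_cone x kmin kmax D"
    "g \<bullet> ind C < g \<bullet> ind D"
proof -
  let ?F = "T \<inter> {z. c \<bullet> z = c \<bullet> ind C}"
  have opt': "\<And>z. z \<in> T \<Longrightarrow> c \<bullet> z \<le> c \<bullet> ind C" using opt by (simp add: normal_cone_def)
  have face: "?F face_of T"
    by (intro face_of_Int_supporting_hyperplane_le convex_T opt')
  have polyF: "polytope ?F" using face_of_polytope_polytope[OF polytope_T[OF C] face] .
  have extF: "ind C extreme_point_of ?F"
    using extreme_point_of_face[OF face] ind_extreme_point[OF C] ind_in_T[OF C] by simp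
  have yF: "y \<in> ?F" using y by simp
  obtain e w where e: "e edge_of ?F" "ind C \<in> e" "w \<in> e" "w extreme_point_of ?F"
      "g \<bullet> ind C < g \<bullet> w"
    by (rule polytope_improving_edge[OF polyF extF yF y(3)])
  have eT: "e edge_of T" using e(1) face face_of_trans[of e ?F T] by (simp add: edge_of_def)
  have "w extreme_point_of T" and cw: "c \<bullet> w = c \<bullet> ind C"
    using extreme_point_of_face[OF face] e(4) by auto
  then have "w \<in> ind ` {C. feasible C}"
    using T_eq_convex_hull[OF C] extreme_point_of_convex_hull by metis
  then obtain D where D: "feasible D" "w = ind D" by auto
  have "C \<noteq> D" using e(5) D(2) by auto
  then have "adjacent x kmin kmax C D"
    using C D eT e(2,3) unfolding adjacent_def feasible_def by metis
  moreover have "c \<in> normal_cone x kmin kmax D" using opt cw D(2) by (simp add: normal_cone_def)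
  ultimately show thesis using that D e(5) by metis
qed

text \<open>If moving only the items of a proper subset \<open>A\<close> of the arcs is possible, then the midpoint
  of \<open>C\<close> and \<open>D\<close> is also the midpoint of two points off the line through \<open>C\<close> and \<open>D\<close>.\<close>

lemma adjacent_imp_single_exchange:
  assumes adj: "adjacent x kmin kmax C D"
  shows "single_cyclical_exchange C D \<or> single_sequential_exchange C D"
proof -
  have C: "feasible C" and D: "feasible D" and neq: "C \<noteq> D"
    using adj by (auto simp: adjacent_def feasible_def)
  obtain e where e: "e face_of T" "aff_dim e = 1" "ind C \<in> e" "ind D \<in> e"
    using adj by (auto simp: adjacent_def edge_of_def)
  have neq': "ind D \<noteq> ind C" using ind_eq_iff[OF C D] neq by metis
  note CDG = exchange_digraph_ind[OF C D]
  obtain p \<theta> where str: "pre_digraph.cycle (CDG C D) p \<or>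
       (\<exists>u v. p \<noteq> [] \<and> pre_digraph.apath (CDG C D) u p v)"
    and A: "set p \<subseteq> arcs (exchange_digraph C (ind D))" "inj_on fst (set p)"
    and \<theta>: "0 < \<theta>" "\<exists>i l j. (i, l, x j) \<in> set p \<and> ind D $ l $ j = \<theta>"
    and T: "ind C + exchange_vector (set p) \<in> T" "ind D - \<theta> *\<^sub>R exchange_vector (set p) \<in> T"
    using exchange_step[OF C ind_in_T[OF D] neq'] unfolding CDG by metis
  obtain i0 l0 j0 where a0: "(i0, l0, x j0) \<in> set p" "ind D $ l0 $ j0 = \<theta>" using \<theta>(2) by metis
  \<comment> \<open>A positive entry of a 0/1 vector is 1, so the step is a whole exchange.\<close>
  have \<theta>1: "\<theta> = 1" using a0(2) \<theta>(1) by (simp add: ind_nth split: if_splits)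
  define a where "a = ind C + exchange_vector (set p)"
  define b where "b = ind D - exchange_vector (set p)"
  have aT: "a \<in> T" "b \<in> T" using T \<theta>1 by (simp_all add: a_def b_def)
  have mid: "midpoint a b = midpoint (ind C) (ind D)"
    by (simp add: a_def b_def midpoint_def algebra_simps)
  have mid_e: "midpoint a b \<in> e"
    unfolding mid using e(3,4) face_of_imp_convex[OF e(1)] convex_contains_segment[of e]
      midpoint_in_closed_segment by blast
  have "a \<in> e"
  proof (cases "a = b")
    case True
    then show ?thesis using mid_e by simp
  next
    case False
    then have "midpoint a b \<in> open_segment a b" by simp
    then show ?thesis using face_ofD[OF e(1) _ aT mid_e] by simp
  qed
  moreover have "affine hull {ind C, ind D} = affine hull e"
  proof (rule affine_dim_equal)
    show "affine hull {ind C, ind D} \<subseteq> affine hull e" using e(3,4) by (intro hull_mono) simp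
    show "aff_dim (affine hull {ind C, ind D}) = aff_dim (affine hull e)"
      using e(2) neq' by (simp add: aff_dim_2)
  qed auto
  ultimately have "a \<in> affine hull {ind C, ind D}" by (simp add: hull_inc)
  then obtain k where k: "a = ind C + k *\<^sub>R (ind D - ind C)"
    by (auto simp: affine_hull_2_alt)
  then have ex_k: "exchange_vector (set p) = k *\<^sub>R (ind D - ind C)" by (simp add: a_def)
  \<comment> \<open>At the head of one arc of \<open>p\<close> the entry rises from 0 to 1 both in
    the exchange and from \<open>C\<close> to \<open>D\<close>, which fixes the factor
    \<open>k\<close>.\<close>
  have "x j0 \<in> C i0" "i0 \<noteq> l0" using subsetD[OF A(1) a0(1)] by auto
  then have "exchange_vector (set p) $ l0 $ j0 = 1" "ind C $ l0 $ j0 = 0"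
    using exchange_vector_nth_arc[OF C A a0(1)] ind_other[OF C, of j0 i0 l0] by auto
  then have "k = 1" using a0(2) \<theta>1 ex_k by simp
  then have ex: "exchange_vector (set p) = ind D - ind C" using ex_k by simp
  \<comment> \<open>Each arc of the difference graph shows up as an entry 1 of
    \<open>ind D - ind C\<close>, and only an arc of \<open>p\<close> with the same item and ends
    can cause it.\<close>
  have "arcs (CDG C D) \<subseteq> set p"
  proof
    fix d assume d: "d \<in> arcs (CDG C D)"
    then obtain i l j where dd: "d = (i, l, x j)" "i \<noteq> l" "x j \<in> C i" "0 < ind D $ l $ j"
      unfolding CDG[symmetric] by (cases d) auto
    have "ind D $ l $ j = 1" using dd(4) by (simp add: ind_nth split: if_splits)
    moreover have "ind C $ l $ j = 0" using ind_other[OF C dd(3)] dd(2) by simp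
    ultimately have one: "exchange_vector (set p) $ l $ j = 1" using ex by simp
    then obtain i' l' where a: "(i', l', x j) \<in> set p"
      using exchange_vector_nth_no_arc[of j "set p" l] by fastforce
    have "x j \<in> C i'" using subsetD[OF A(1) a] by simp
    then have "i' = i" using C dd(3) clustering_unique[of C "x j" i' i] by (simp add: feasible_def)
    moreover have "l' = l"
      using one exchange_vector_nth_arc[OF C A a, of l] by (auto split: if_splits simp: of_bool_def)
    ultimately show "d \<in> set p" using a dd(1) by simp
  qed
  then have eq: "set p = arcs (CDG C D)" using A(1) CDG by simp
  show ?thesis
    using str
  proof (elim disjE exE conjE)
    assume "pre_digraph.cycle (CDG C D) p"
    then show ?thesis using eq unfolding single_cyclical_exchange_def by blast
  next
    fix u v assume "p \<noteq> []" "pre_digraph.apath (CDG C D) u p v"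
    then show ?thesis using eq unfolding single_sequential_exchange_def by blast
  qed
qed

subsection \<open>Dual potentials\<close>

lemma inner_entries: "(c :: real^'n^'k) \<bullet> y = (\<Sum>i\<in>UNIV. \<Sum>j\<in>UNIV. c $ i $ j * y $ i $ j)"
  by (simp add: inner_vec_def)

lemma sum_cluster_size:
  assumes "y \<in> T"
  shows "(\<Sum>i\<in>UNIV. cluster_size y i) = real CARD('n)"
  unfolding cluster_size_def by (subst sum.swap) (simp add: T_sum[OF assms])

text \<open>\<open>\<gamma>\<close> is a vector of dual prices: after subtracting prices each item
  is in a best cluster, and the second family encodes the signs of the multipliers of the size
  bounds. If no prices existed, a Farkas certificate would be an improving feasible direction at
  \<open>C\<close>.\<close>

lemma optimal_imp_potentials:
  assumes C: "feasible C" and opt: "c \<in> normal_cone x kmin kmax C"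
  obtains \<gamma> :: "real^'k" where
    "\<And>i l j. x j \<in> C i \<Longrightarrow> c $ l $ j - c $ i $ j \<le> \<gamma> $ l - \<gamma> $ i"
    "\<And>p q. card (C p) < kmax p \<Longrightarrow> kmin q < card (C q) \<Longrightarrow> \<gamma> $ p \<le> \<gamma> $ q"
proof -
  define R where "R = {(i, l, j). x j \<in> C i \<and> l \<in> (UNIV :: 'k set)}"
  define V where "V = {(p, q). card (C p) < kmax p \<and> kmin q < card (C q)}"
  \<comment> \<open>Left summands are reassignments of single items, right summands pair a cluster
    \<open>p\<close> that may grow with a cluster \<open>q\<close> that may shrink.\<close>
  define a :: "'k \<times> 'k \<times> 'n + 'k \<times> 'k \<Rightarrow> real^'k" where
    "a = case_sum (\<lambda>(i, l, j). axis l 1 - axis i 1) (\<lambda>(p, q). axis q 1 - axis p 1)"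
  define b :: "'k \<times> 'k \<times> 'n + 'k \<times> 'k \<Rightarrow> real" where
    "b = case_sum (\<lambda>(i, l, j). c $ l $ j - c $ i $ j) (\<lambda>_. 0)"
  have "finite (R <+> V)" by (intro finite_Plus) simp_all
  then show thesis
  proof (cases rule: farkas_alternative[of "R <+> V" b a])
    case (1 \<gamma>)
    have "c $ l $ j - c $ i $ j \<le> \<gamma> $ l - \<gamma> $ i" if "x j \<in> C i" for i l j
    proof -
      have "Inl (i, l, j) \<in> R <+> V" using that by (intro InlI) (simp add: R_def)
      from 1(1)[OF this] show ?thesis
        by (simp add: a_def b_def inner_diff_left inner_axis')
    qed
    moreover have "\<gamma> $ p \<le> \<gamma> $ q" if "card (C p) < kmax p" "kmin q < card (C q)" for p q
    proof -
      have "Inr (p, q) \<in> R <+> V" using that by (intro InrI) (simp add: V_def)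
      from 1(1)[OF this] show ?thesis
        by (simp add: a_def b_def inner_diff_left inner_axis')
    qed
    ultimately show thesis by (rule that)
  next
    case (2 w)
    have w: "\<And>r. r \<in> R \<Longrightarrow> 0 \<le> w (Inl r)" "\<And>e. e \<in> V \<Longrightarrow> 0 \<le> w (Inr e)"
      using 2(1) by auto
    \<comment> \<open>The certificate read as a direction: \<open>w\<close> is the amount of item
      \<open>j\<close> moved from its cluster \<open>i\<close> to \<open>l\<close>.\<close>
    define d :: "real^'n^'k" where
      "d = (\<Sum>(i, l, j)\<in>R. w (Inl (i, l, j)) *\<^sub>R (axis l (axis j 1) - axis i (axis j 1)))"
    have d_nth: "d $ m $ j' = (\<Sum>(i, l, j)\<in>R. w (Inl (i, l, j)) *
        (of_bool (m = l \<and> j' = j) - of_bool (m = i \<and> j' = j)))" for m j'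
      unfolding d_def by (auto simp: axis_def case_prod_beta intro!: sum.cong)
    \<comment> \<open>The vanishing combination of the rows balances sizes: the net amount that
      reassignments bring into a cluster is its net inflow when each pair sends \<open>w\<close>
      from \<open>q\<close> to \<open>p\<close>.\<close>
    have bal: "(\<Sum>(i, l, j)\<in>R. w (Inl (i, l, j)) * (of_bool (m = l) - of_bool (m = i))) =
        (\<Sum>(p, q)\<in>V. w (Inr (p, q)) * (of_bool (m = p) - of_bool (m = q)))" for m
    proof -
      have "(\<Sum>r\<in>R. w (Inl r) *\<^sub>R a (Inl r)) + (\<Sum>e\<in>V. w (Inr e) *\<^sub>R a (Inr e)) = 0"
        using 2(2) by (simp add: sum.Plus comp_def)
      from arg_cong[OF this, of "\<lambda>z. z $ m"]
      have "(\<Sum>(i, l, j)\<in>R. w (Inl (i, l, j)) * (of_bool (m = l) - of_bool (m = i))) +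
        (\<Sum>(p, q)\<in>V. w (Inr (p, q)) * (of_bool (m = q) - of_bool (m = p))) = 0"
        by (simp add: a_def case_prod_beta axis_def of_bool_def)
      moreover have "(\<Sum>(p, q)\<in>V. w (Inr (p, q)) * (of_bool (m = q) - of_bool (m = p))) =
          - (\<Sum>(p, q)\<in>V. w (Inr (p, q)) * (of_bool (m = p) - of_bool (m = q)))"
        by (simp add: sum_negf[symmetric] case_prod_beta algebra_simps)
      ultimately show ?thesis by simp
    qed
    have size: "cluster_size d m = (\<Sum>(p, q)\<in>V. w (Inr (p, q)) * (of_bool (m = p) - of_bool (m = q)))" for m
    proof -
      have "cluster_size d m = (\<Sum>(i, l, j)\<in>R. \<Sum>j'\<in>UNIV. w (Inl (i, l, j)) *
        (of_bool (m = l \<and> j' = j) - of_bool (m = i \<and> j' = j)))"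
        unfolding cluster_size_def d_nth case_prod_beta by (rule sum.swap)
      also have "\<dots> = (\<Sum>(i, l, j)\<in>R. w (Inl (i, l, j)) * (of_bool (m = l) - of_bool (m = i)))"
        by (intro sum.cong) (auto simp: sum_distrib_left[symmetric] sum_subtractf of_bool_conj)
      finally show ?thesis unfolding bal .
    qed
    have col: "(\<Sum>m\<in>UNIV. d $ m $ j') = 0" for j'
    proof -
      have "(\<Sum>m\<in>UNIV. d $ m $ j') = (\<Sum>(i, l, j)\<in>R. \<Sum>m\<in>UNIV. w (Inl (i, l, j)) *
        (of_bool (m = l \<and> j' = j) - of_bool (m = i \<and> j' = j)))"
        unfolding d_nth case_prod_beta by (rule sum.swap)
      also have "\<dots> = 0"
        by (intro sum.neutral) (auto simp: sum_distrib_left[symmetric] sum_subtractf of_bool_conj)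
      finally show ?thesis .
    qed
    have cd: "c \<bullet> d = 1"
    proof -
      have "c \<bullet> d = (\<Sum>(i, l, j)\<in>R. w (Inl (i, l, j)) * (c $ l $ j - c $ i $ j))"
        unfolding d_def
        by (simp add: inner_sum_right case_prod_beta inner_diff_right inner_axis)
      also have "\<dots> = (\<Sum>r\<in>R <+> V. w r * b r)"
        by (simp add: sum.Plus comp_def b_def case_prod_beta)
      finally show ?thesis using 2(3) by simp
    qed
    have entry: "0 \<le> d $ m $ j'" if "x j' \<notin> C m" for m j'
      unfolding d_nth using w(1) that by (intro sum_nonneg) (auto simp: R_def)
    \<comment> \<open>A cluster at its lower bound never occurs as \<open>q\<close>, one at its
      upper bound never as \<open>p\<close>.\<close>
    have low: "0 \<le> cluster_size d m" if "card (C m) = kmin m" for m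
      unfolding size using w(2) that by (intro sum_nonneg) (auto simp: V_def)
    have up: "cluster_size d m \<le> 0" if "card (C m) = kmax m" for m
      unfolding size using w(2) that by (intro sum_nonpos) (auto simp: V_def mult_le_0_iff)
    have indT: "ind C \<in> T" using C by (rule ind_in_T)
    have card: "cluster_size (ind C) m = real (card (C m))"
      "real (kmin m) \<le> cluster_size (ind C) m" "cluster_size (ind C) m \<le> real (kmax m)" for m
      using C indT cluster_size_ind by (auto simp: feasible_def transportation_polytope_iff)
    \<comment> \<open>There are finitely many constraints and \<open>d\<close> has the right sign on
      those tight at \<open>C\<close>, so a short step stays in \<open>T\<close>; since
      \<open>c\<close> has value 1 on \<open>d\<close>, it contradicts optimality.\<close>
    have "\<forall>\<^sub>F t in at_right 0. \<forall>m j. 0 \<le> ind C $ m $ j + t * d $ m $ j"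
      using entry by (intro eventually_all_finite eventually_affine_nonneg)
        (auto simp: ind_nth split: if_splits)
    moreover have "\<forall>\<^sub>F t in at_right 0. \<forall>m. 0 \<le> (cluster_size (ind C) m - kmin m) + t * cluster_size d m"
      using low card by (intro eventually_all_finite eventually_affine_nonneg) auto
    moreover have "\<forall>\<^sub>F t in at_right 0. \<forall>m. 0 \<le> (kmax m - cluster_size (ind C) m) + t * (- cluster_size d m)"
      using up card by (intro eventually_all_finite eventually_affine_nonneg) auto
    moreover have "\<forall>\<^sub>F t in at_right (0::real). 0 < t" by (rule eventually_at_right_less)
    ultimately have "\<forall>\<^sub>F t in at_right 0. 0 < t \<and> ind C + t *\<^sub>R d \<in> T"
    proof eventually_elim
      case (elim t)
      have "(\<Sum>i\<in>UNIV. (ind C + t *\<^sub>R d) $ i $ j) = 1" for j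
        using T_sum[OF indT] col[of j] by (simp add: sum.distrib sum_distrib_left[symmetric])
      moreover have "real (kmin m) \<le> cluster_size (ind C + t *\<^sub>R d) m \<and>
          cluster_size (ind C + t *\<^sub>R d) m \<le> real (kmax m)" for m
        using elim(2,3) by (auto simp: cluster_size_linear algebra_simps)
      ultimately show ?case using elim(1,4) by (simp add: transportation_polytope_iff)
    qed
    then have "\<exists>t. 0 < t \<and> ind C + t *\<^sub>R d \<in> T"
      by (rule eventually_happens'[OF trivial_limit_at_right_real])
    then obtain t where t: "0 < t" "ind C + t *\<^sub>R d \<in> T" by blast
    then have "c \<bullet> (ind C + t *\<^sub>R d) \<le> c \<bullet> ind C" using opt by (simp add: normal_cone_def)
    then show thesis using t(1) cd by (simp add: inner_add_right)
  qed
qed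

text \<open>The potentials are an optimal solution of the dual linear program; complementary slackness
  makes them valid for every other optimal point.\<close>

lemma optimal_potentials_shared:
  assumes C: "feasible C" and opt: "c \<in> normal_cone x kmin kmax C"
  obtains \<gamma> :: "real^'k" where
    "\<And>y i l j. y \<in> T \<Longrightarrow> c \<bullet> y = c \<bullet> ind C \<Longrightarrow> 0 < y $ i $ j \<Longrightarrow>
       c $ l $ j - c $ i $ j \<le> \<gamma> $ l - \<gamma> $ i"
proof -
  obtain \<gamma> :: "real^'k" where \<gamma>: "\<And>i l j. x j \<in> C i \<Longrightarrow> c $ l $ j - c $ i $ j \<le> \<gamma> $ l - \<gamma> $ i"
    "\<And>p q. card (C p) < kmax p \<Longrightarrow> kmin q < card (C q) \<Longrightarrow> \<gamma> $ p \<le> \<gamma> $ q"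
    using optimal_imp_potentials[OF C opt] by metis
  have cl: "clustering (range x) C" using C by (simp add: feasible_def)
  have "\<forall>j. \<exists>i. x j \<in> C i" using clustering_obtain[OF cl] by metis
  then obtain own where own: "\<And>j. x j \<in> C (own j)" by metis
  have ind_own: "ind C $ i $ j = of_bool (i = own j)" for i j
    using ind_other[OF C own, of i j] own[of j] by (cases "i = own j") (simp_all add: ind_nth)
  \<comment> \<open>\<open>f l j\<close> is the reduced cost of putting item \<open>j\<close> into
    \<open>l\<close> instead of its own cluster.\<close>
  define f where "f l j = c $ own j $ j - \<gamma> $ own j + \<gamma> $ l - c $ l $ j" for l j
  have f_nonneg: "0 \<le> f l j" for l j using \<gamma>(1)[OF own, of l j] by (simp add: f_def)
  have sum_f: "(\<Sum>l\<in>UNIV. \<Sum>j\<in>UNIV. y $ l $ j * f l j) =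
      (\<Sum>j\<in>UNIV. c $ own j $ j - \<gamma> $ own j) + (\<Sum>l\<in>UNIV. \<gamma> $ l * cluster_size y l) - c \<bullet> y"
    if y: "y \<in> T" for y
  proof -
    have "(\<Sum>l\<in>UNIV. \<Sum>j\<in>UNIV. y $ l $ j * f l j) =
        (\<Sum>l\<in>UNIV. \<Sum>j\<in>UNIV. y $ l $ j * (c $ own j $ j - \<gamma> $ own j))
        + (\<Sum>l\<in>UNIV. \<Sum>j\<in>UNIV. \<gamma> $ l * y $ l $ j) - (\<Sum>l\<in>UNIV. \<Sum>j\<in>UNIV. c $ l $ j * y $ l $ j)"
      by (simp add: f_def sum.distrib[symmetric] sum_subtractf[symmetric] algebra_simps)
    also have "(\<Sum>l\<in>UNIV. \<Sum>j\<in>UNIV. y $ l $ j * (c $ own j $ j - \<gamma> $ own j)) =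
        (\<Sum>j\<in>UNIV. c $ own j $ j - \<gamma> $ own j)"
      by (subst sum.swap) (simp add: sum_distrib_right[symmetric] T_sum[OF y])
    finally show ?thesis
      by (simp add: inner_entries cluster_size_def sum_distrib_left)
  qed
  have "c $ l $ j - c $ i $ j \<le> \<gamma> $ l - \<gamma> $ i"
    if y: "y \<in> T" "c \<bullet> y = c \<bullet> ind C" "0 < y $ i $ j" for y i l j
  proof -
    let ?\<delta> = "\<lambda>l. cluster_size y l - cluster_size (ind C) l"
    have zero: "(\<Sum>l\<in>UNIV. \<Sum>j\<in>UNIV. ind C $ l $ j * f l j) = 0"
    proof -
      have "ind C $ l $ j * f l j = 0" for l j by (cases "l = own j") (simp_all add: ind_own f_def)
      then show ?thesis by (simp only: sum.neutral_const)
    qed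
    \<comment> \<open>A cluster that grows from \<open>C\<close> to \<open>y\<close> is below its
      maximum in \<open>C\<close>, one that shrinks is above its minimum, so the prices are ordered
      as the threshold argument requires.\<close>
    have "(\<Sum>l\<in>UNIV. \<gamma> $ l * ?\<delta> l) \<le> 0"
    proof (rule sum_mult_nonpos_of_threshold)
      show "(\<Sum>l\<in>UNIV. ?\<delta> l) = 0"
        by (simp add: sum_subtractf sum_cluster_size y(1) ind_in_T[OF C])
    next
      fix p q assume "0 < ?\<delta> p" "?\<delta> q < 0"
      moreover have "cluster_size y p \<le> kmax p" "kmin q \<le> cluster_size y q"
        using y(1) by (auto simp: transportation_polytope_iff)
      ultimately show "\<gamma> $ p \<le> \<gamma> $ q"
        by (intro \<gamma>(2)) (simp_all add: cluster_size_ind[OF cl])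
    qed simp
    \<comment> \<open>At equal objective value the total reduced cost of \<open>y\<close> exceeds
      that of \<open>C\<close>, which is 0, by exactly the sum just bounded. Its terms are
      nonnegative, so all of them vanish.\<close>
    then have "(\<Sum>l\<in>UNIV. \<Sum>j\<in>UNIV. y $ l $ j * f l j) \<le> 0"
      using sum_f[OF y(1)] sum_f[OF ind_in_T[OF C]] zero y(2)
      by (simp add: right_diff_distrib sum_subtractf)
    moreover have nonneg: "0 \<le> y $ l $ j * f l j" for l j using f_nonneg T_nonneg[OF y(1)] by simp
    moreover have "y $ i $ j * f i j \<le> (\<Sum>j\<in>UNIV. y $ i $ j * f i j)"
      using nonneg by (intro member_le_sum) auto
    moreover have "(\<Sum>j\<in>UNIV. y $ i $ j * f i j) \<le> (\<Sum>l\<in>UNIV. \<Sum>j\<in>UNIV. y $ l $ j * f l j)"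
      using nonneg by (intro member_le_sum[of i UNIV "\<lambda>l. \<Sum>j\<in>UNIV. y $ l $ j * f l j"] sum_nonneg) auto
    ultimately have "y $ i $ j * f i j \<le> 0" by linarith
    then have "f i j \<le> 0" using y(3) by (simp add: mult_le_0_iff)
    then show ?thesis using f_nonneg[of l j] by (simp add: f_def)
  qed
  then show thesis by (rule that)
qed

subsection \<open>Parametric objectives\<close>

lemma objective_inner_ind:
  assumes "clustering (range x) C"
  shows "objective x a \<bullet> ind C = a \<bullet> clustering_vector C"
proof -
  have "a $ i \<bullet> (\<Sum>z\<in>C i. z) = (\<Sum>j\<in>UNIV. x j \<bullet> a $ i * (if x j \<in> C i then 1 else 0))" for i
  proof -
    have "C i \<subseteq> range x" using assms by (auto simp: clustering_def)
    then have Ci: "C i = x ` {j. x j \<in> C i}" by auto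
    have "(\<Sum>z\<in>C i. a $ i \<bullet> z) = (\<Sum>z\<in>x ` {j. x j \<in> C i}. a $ i \<bullet> z)"
      using Ci by (rule arg_cong)
    also have "\<dots> = (\<Sum>j\<in>{j. x j \<in> C i}. x j \<bullet> a $ i)"
      by (subst sum.reindex) (auto intro: inj_on_subset[OF inj_x] simp: inner_commute)
    also have "\<dots> = (\<Sum>j\<in>UNIV. if x j \<in> C i then x j \<bullet> a $ i else 0)"
      by (simp add: sum.If_cases)
    also have "\<dots> = (\<Sum>j\<in>UNIV. x j \<bullet> a $ i * (if x j \<in> C i then 1 else 0))"
      by (intro sum.cong) auto
    finally show ?thesis by (simp add: inner_sum_right)
  qed
  then show ?thesis
    unfolding inner_entries by (simp add: inner_vec_def[of a] clustering_vector_def objective_def ind_nth)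
qed

lemma normal_cone_iff:
  assumes "feasible C"
  shows "c \<in> normal_cone x kmin kmax C \<longleftrightarrow> (\<forall>D. feasible D \<longrightarrow> c \<bullet> ind D \<le> c \<bullet> ind C)"
  using T_le_maximizer[OF assms] ind_in_T by (auto simp: normal_cone_def)

text \<open>The two objectives agree on clusterings, and maximising a linear functional over either
  polytope reduces to the feasible clusterings.\<close>

lemma radial_iff:
  "radial (range x) kmin kmax a C \<longleftrightarrow> feasible C \<and> objective x a \<in> normal_cone x kmin kmax C"
proof (cases "feasible C")
  case True
  let ?W = "{clustering_vector D | D. clustering (range x) D \<and> within_bounds kmin kmax D}"
  have "(\<forall>w\<in>partition_polytope (range x) kmin kmax. a \<bullet> w \<le> a \<bullet> clustering_vector C) \<longleftrightarrow>
      (\<forall>w\<in>?W. a \<bullet> w \<le> a \<bullet> clustering_vector C)"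
    using convex_hull_subset_halfspace_le[of ?W a "a \<bullet> clustering_vector C"] hull_subset[of ?W convex]
    unfolding partition_polytope_def by blast
  also have "\<dots> \<longleftrightarrow> (\<forall>D. feasible D \<longrightarrow> objective x a \<bullet> ind D \<le> objective x a \<bullet> ind C)"
    using True by (auto simp: objective_inner_ind feasible_def)
  finally show ?thesis using True normal_cone_iff[OF True] by (simp add: radial_def feasible_def)
qed (auto simp: radial_def feasible_def)

lemma objective_sites_at:
  "objective x (sites_at s t \<nu>) = (1 - \<nu>) *\<^sub>R objective x s + \<nu> *\<^sub>R objective x t"
  by (simp add: vec_eq_iff objective_def sites_at_def inner_add_right)

lemma objective_midpoint_in_normal_cone:
  assumes "objective x a \<in> normal_cone x kmin kmax C" "objective x b \<in> normal_cone x kmin kmax C"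
  shows "objective x ((1/2) *\<^sub>R (a + b)) \<in> normal_cone x kmin kmax C"
proof -
  have "objective x ((1/2) *\<^sub>R (a + b)) = (1/2) *\<^sub>R (objective x a + objective x b)"
    by (simp add: vec_eq_iff objective_def inner_add_right)
  then show ?thesis using assms by (auto simp: normal_cone_def inner_add_left intro!: add_mono)
qed

text \<open>The parameters in \<open>[lam, 1]\<close> at which \<open>C\<close> is optimal form a
  nonempty compact set; its maximum is the breakpoint.\<close>

lemma next_breakpoint_exists:
  assumes "lam \<le> 1" "objective x (sites_at s t lam) \<in> normal_cone x kmin kmax C"
  obtains \<mu> where "next_breakpoint x kmin kmax s t C lam \<mu>"
proof -
  define M where "M = {\<mu> \<in> {lam..1}. objective x (sites_at s t \<mu>) \<in> normal_cone x kmin kmax C}"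
  have "M = {lam..1} \<inter> (\<Inter>y\<in>T. {\<mu>. objective x (sites_at s t \<mu>) \<bullet> y \<le> objective x (sites_at s t \<mu>) \<bullet> ind C})"
    by (auto simp: M_def normal_cone_def)
  moreover have "closed {\<mu>. objective x (sites_at s t \<mu>) \<bullet> y \<le> objective x (sites_at s t \<mu>) \<bullet> ind C}" for y
    unfolding objective_sites_at by (intro closed_Collect_le continuous_intros)
  ultimately have "compact M" by (auto intro!: compact_Int_closed closed_INT)
  moreover have "M \<noteq> {}" using assms by (auto simp: M_def)
  ultimately have "\<exists>s\<in>M. \<forall>t\<in>M. t \<le> s" by (rule compact_attains_sup)
  then obtain \<mu> where \<mu>: "\<mu> \<in> M" "\<And>\<nu>. \<nu> \<in> M \<Longrightarrow> \<nu> \<le> \<mu>" by blast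
  have "next_breakpoint x kmin kmax s t C lam \<mu>"
    unfolding next_breakpoint_def
  proof (intro conjI allI impI)
    fix \<nu> assume \<nu>: "\<mu> < \<nu> \<and> \<nu> \<le> 1"
    show "objective x (sites_at s t \<nu>) \<notin> normal_cone x kmin kmax C"
    proof
      assume "objective x (sites_at s t \<nu>) \<in> normal_cone x kmin kmax C"
      then have "\<nu> \<in> M" using \<nu> \<mu>(1) by (simp add: M_def)
      then have "\<nu> \<le> \<mu>" by (rule \<mu>(2))
      then show False using \<nu> by simp
    qed
  qed (use \<mu>(1) in \<open>auto simp: M_def\<close>)
  then show thesis by (rule that)
qed

text \<open>Past \<open>\<mu>\<close> the objective changes in direction \<open>c(t) - c(s)\<close>.
  If no clustering tied at \<open>\<mu>\<close> gained in this direction, the finitely many strictly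
  worse ones would need a positive time to catch up, and \<open>C\<close> would stay optimal beyond
  the breakpoint.\<close>

lemma next_breakpoint_improving:
  assumes C: "feasible C" and \<mu>: "next_breakpoint x kmin kmax s t C lam \<mu>" "\<mu> < 1"
  obtains D where "feasible D"
    "objective x (sites_at s t \<mu>) \<bullet> ind D = objective x (sites_at s t \<mu>) \<bullet> ind C"
    "(objective x t - objective x s) \<bullet> ind C < (objective x t - objective x s) \<bullet> ind D"
proof -
  let ?c = "\<lambda>\<nu>. objective x (sites_at s t \<nu>)" and ?g = "objective x t - objective x s"
  have opt: "?c \<mu> \<bullet> ind D \<le> ?c \<mu> \<bullet> ind C" if "feasible D" for D
    using \<mu>(1) normal_cone_iff[OF C] that by (simp add: next_breakpoint_def)
  have "\<exists>D. feasible D \<and> ?c \<mu> \<bullet> ind D = ?c \<mu> \<bullet> ind C \<and> ?g \<bullet> ind C < ?g \<bullet> ind D"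
  proof (rule ccontr)
    assume contra: "\<not> ?thesis"
    have shift: "?c \<nu> = ?c \<mu> + (\<nu> - \<mu>) *\<^sub>R ?g" for \<nu>
      unfolding objective_sites_at by (simp add: algebra_simps)
    have "\<forall>\<^sub>F \<delta> in at_right 0. 0 \<le> ?c \<mu> \<bullet> (ind C - ind D) + \<delta> * (?g \<bullet> (ind C - ind D))"
      if "feasible D" for D
    proof (rule eventually_affine_nonneg)
      show "0 \<le> ?c \<mu> \<bullet> (ind C - ind D)" using opt[OF that] by (simp add: inner_diff_right)
      assume "?c \<mu> \<bullet> (ind C - ind D) = 0"
      then have "?c \<mu> \<bullet> ind D = ?c \<mu> \<bullet> ind C" by (simp add: inner_diff_right)
      then have "\<not> ?g \<bullet> ind C < ?g \<bullet> ind D" using contra \<open>feasible D\<close> by blast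
      then show "0 \<le> ?g \<bullet> (ind C - ind D)" by (simp add: inner_diff_right)
    qed
    then have "\<forall>\<^sub>F \<delta> in at_right 0. \<forall>D\<in>{D. feasible D}. 0 \<le> ?c \<mu> \<bullet> (ind C - ind D) + \<delta> * (?g \<bullet> (ind C - ind D))"
      by (intro eventually_ball_finite finite_feasible) auto
    moreover have "\<forall>\<^sub>F \<delta> in at_right 0. \<delta> \<in> {0<..<1 - \<mu>}"
      using \<mu>(2) by (intro eventually_at_right_real) simp
    ultimately have "\<forall>\<^sub>F \<delta> in at_right 0. \<delta> \<in> {0<..<1 - \<mu>} \<and>
        (\<forall>D. feasible D \<longrightarrow> 0 \<le> ?c \<mu> \<bullet> (ind C - ind D) + \<delta> * (?g \<bullet> (ind C - ind D)))"
      by eventually_elim auto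
    then have "\<exists>\<delta>. \<delta> \<in> {0<..<1 - \<mu>} \<and>
        (\<forall>D. feasible D \<longrightarrow> 0 \<le> ?c \<mu> \<bullet> (ind C - ind D) + \<delta> * (?g \<bullet> (ind C - ind D)))"
      by (rule eventually_happens'[OF trivial_limit_at_right_real])
    then obtain \<delta> where \<delta>: "\<delta> \<in> {0<..<1 - \<mu>}"
      "\<And>D. feasible D \<Longrightarrow> 0 \<le> ?c \<mu> \<bullet> (ind C - ind D) + \<delta> * (?g \<bullet> (ind C - ind D))" by blast
    have "?c (\<mu> + \<delta>) \<bullet> ind D \<le> ?c (\<mu> + \<delta>) \<bullet> ind C" if "feasible D" for D
      using \<delta>(2)[OF that] unfolding shift[of "\<mu> + \<delta>"]
      by (simp add: inner_diff_right inner_add_left right_diff_distrib)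
    then have "?c (\<mu> + \<delta>) \<in> normal_cone x kmin kmax C" using normal_cone_iff[OF C] by blast
    then show False using \<mu>(1) \<delta>(1) by (auto simp: next_breakpoint_def)
  qed
  then show thesis using that by blast
qed

text \<open>One \<open>\<gamma>\<close> serves all clusterings optimal for \<open>a\<close> at once,
  which is what makes a shared diagram possible.\<close>

lemma optimal_separable:
  assumes C: "feasible C" and opt: "objective x a \<in> normal_cone x kmin kmax C"
  obtains \<gamma> :: "real^'k" where
    "\<And>D i l z. feasible D \<Longrightarrow> objective x a \<in> normal_cone x kmin kmax D \<Longrightarrow> z \<in> D i \<Longrightarrow>
       (a $ l - a $ i) \<bullet> z \<le> \<gamma> $ l - \<gamma> $ i"
proof -
  obtain \<gamma> :: "real^'k" where \<gamma>: "\<And>y i l j. y \<in> T \<Longrightarrow> objective x a \<bullet> y = objective x a \<bullet> ind C \<Longrightarrow>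
      0 < y $ i $ j \<Longrightarrow> objective x a $ l $ j - objective x a $ i $ j \<le> \<gamma> $ l - \<gamma> $ i"
    using optimal_potentials_shared[OF C opt] by metis
  have "(a $ l - a $ i) \<bullet> z \<le> \<gamma> $ l - \<gamma> $ i"
    if D: "feasible D" "objective x a \<in> normal_cone x kmin kmax D" "z \<in> D i" for D i l z
  proof -
    have "clustering (range x) D" using D(1) by (simp add: feasible_def)
    then obtain j where j: "z = x j" using D(3) by (rule clustering_mem_range)
    have "objective x a \<bullet> ind D = objective x a \<bullet> ind C"
      using D(1,2) C opt normal_cone_iff by (metis order_antisym)
    then have "objective x a $ l $ j - objective x a $ i $ j \<le> \<gamma> $ l - \<gamma> $ i"
      using D(3) j by (intro \<gamma>[OF ind_in_T[OF D(1)]]) (simp_all add: ind_nth)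
    then show ?thesis by (simp add: objective_def j inner_diff_right inner_commute[of _ "x j"])
  qed
  then show thesis by (rule that)
qed

text \<open>The 0/1 vectors of clusterings have equal norm, so their inner product, the number of
  items on which they agree, is largest only for equal clusterings.\<close>

lemma ind_inner_less:
  assumes "feasible C" "feasible D" "C \<noteq> D"
  shows "ind D \<bullet> ind C < ind D \<bullet> ind D"
proof -
  have self: "ind E \<bullet> ind E = real CARD('n)" if "feasible E" for E
  proof -
    have "ind E \<bullet> ind E = (\<Sum>i\<in>UNIV. cluster_size (ind E) i)"
      unfolding inner_entries cluster_size_def by (intro sum.cong) (auto simp: ind_nth)
    then show ?thesis using sum_cluster_size ind_in_T[OF that] by simp
  qed
  have "0 < (ind C - ind D) \<bullet> (ind C - ind D)"
    using assms ind_eq_iff by simp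
  then show ?thesis using self[OF assms(1)] self[OF assms(2)]
    by (simp add: inner_diff_left inner_diff_right inner_commute)
qed

text \<open>Termination measure for an increasing objective: the number of clusterings still better
  than the current one.\<close>

lemma card_better_less:
  assumes "feasible D" "h \<bullet> ind C < h \<bullet> ind D"
  shows "card {E. feasible E \<and> h \<bullet> ind D < h \<bullet> ind E} < card {E. feasible E \<and> h \<bullet> ind C < h \<bullet> ind E}"
proof (rule psubset_card_mono)
  show "finite {E. feasible E \<and> h \<bullet> ind C < h \<bullet> ind E}"
    using finite_feasible by (rule rev_finite_subset) auto
  show "{E. feasible E \<and> h \<bullet> ind D < h \<bullet> ind E} \<subset> {E. feasible E \<and> h \<bullet> ind C < h \<bullet> ind E}"
    using assms by force
qed

end

section \<open>Power diagram subroutines\<close>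

text \<open>If the margins are bounded, their supremum is attained: a Farkas certificate against it
  would keep all feasible margins at distance at least \<open>1 / N\<close> below it.\<close>

lemma margin_solution_exists:
  fixes a :: "real^'d^'k::{finite,linorder}"
  assumes fin: "\<And>i. finite (C i)"
    and sep: "\<And>i l z. i \<noteq> l \<Longrightarrow> z \<in> C i \<Longrightarrow> (a $ l - a $ i) \<bullet> z \<le> \<gamma> $ l - \<gamma> $ i"
  obtains \<delta> where "margin_solution a C \<delta>"
proof -
  \<comment> \<open>Only differences of coordinates enter the inequalities, so subtracting the first
    one enforces the normalisation.\<close>
  define shift :: "(real, 'k) vec \<Rightarrow> (real, 'k) vec" where "shift g = (\<chi> i. g $ i - g $ first_label)" for g
  let ?E = "{\<epsilon>. \<exists>\<gamma>. margin_feasible a C \<gamma> \<epsilon>}"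
  have feas0: "margin_feasible a C (shift \<gamma>) 0"
    using sep by (simp add: margin_feasible_def shift_def)
  show thesis
  proof (cases "bdd_above ?E")
    case False
    then have "margin_solution a C (shift \<gamma>)" using feas0 unfolding margin_solution_def by metis
    then show thesis by (rule that)
  next
    case bdd: True
    define I where "I = {(i, l, z). i \<noteq> l \<and> z \<in> C i}"
    have "I \<subseteq> UNIV \<times> UNIV \<times> (\<Union>i. C i)" by (auto simp: I_def)
    then have finI: "finite I" by (rule finite_subset) (simp add: fin)
    define \<sigma> where "\<sigma> = Sup ?E"
    have le_\<sigma>: "\<epsilon> \<le> \<sigma>" if "margin_feasible a C \<gamma> \<epsilon>" for \<epsilon> \<gamma>
      unfolding \<sigma>_def using that bdd by (intro cSup_upper) auto
    have "\<exists>\<gamma>. margin_feasible a C \<gamma> \<sigma>"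
    proof (rule farkas_alternative[OF finI,
        of "\<lambda>(i, l, z). (a $ l - a $ i) \<bullet> z + \<sigma> * norm (a $ l - a $ i)"
          "\<lambda>(i, l, z). axis l 1 - axis i 1 :: (real, 'k) vec"], goal_cases)
      case (1 g)
      have "(a $ l - a $ i) \<bullet> z + \<sigma> * norm (a $ l - a $ i) \<le> g $ l - g $ i"
        if "i \<noteq> l" "z \<in> C i" for i l z
        using 1[of "(i, l, z)"] that by (simp add: I_def inner_diff_left inner_axis')
      then have "margin_feasible a C (shift g) \<sigma>"
        using le_\<sigma>[OF feas0] by (simp add: margin_feasible_def shift_def)
      then show ?case by metis
    next
      case (2 w)
      define B where "B = (\<Sum>(i, l, z)\<in>I. w (i, l, z) * ((a $ l - a $ i) \<bullet> z))"
      define N where "N = (\<Sum>(i, l, z)\<in>I. w (i, l, z) * norm (a $ l - a $ i))"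
      have BN: "B + \<sigma> * N = 1"
        using 2(3) unfolding B_def N_def
        by (simp add: case_prod_beta sum_distrib_left sum.distrib[symmetric] algebra_simps)
      have N: "0 \<le> N" unfolding N_def using 2(1) by (intro sum_nonneg) auto
      have BN_le: "B + \<epsilon> * N \<le> 0" if feas: "margin_feasible a C \<gamma> \<epsilon>" for \<epsilon> \<gamma>
      proof -
        have "B + \<epsilon> * N = (\<Sum>(i, l, z)\<in>I. w (i, l, z) * ((a $ l - a $ i) \<bullet> z + \<epsilon> * norm (a $ l - a $ i)))"
          unfolding B_def N_def
          by (simp add: case_prod_beta sum_distrib_left sum.distrib[symmetric] algebra_simps)
        also have "\<dots> \<le> (\<Sum>(i, l, z)\<in>I. w (i, l, z) * (\<gamma> $ l - \<gamma> $ i))"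
          using feas 2(1) by (intro sum_mono) (auto simp: margin_feasible_def I_def intro!: mult_left_mono)
        also have "\<dots> = (\<Sum>e\<in>I. w e *\<^sub>R (case e of (i, l, z) \<Rightarrow> axis l 1 - axis i 1)) \<bullet> \<gamma>"
          by (simp add: inner_sum_left case_prod_beta inner_diff_left inner_axis')
        finally show ?thesis using 2(2) by simp
      qed
      \<comment> \<open>Margin 0 is feasible, so \<open>B\<close> is at most 0, and
        \<open>N = 0\<close> would contradict \<open>B + \<sigma> * N = 1\<close>.\<close>
      have "N \<noteq> 0" using BN BN_le[OF feas0] by auto
      then have N: "0 < N" using N by simp
      have "\<sigma> \<le> \<sigma> - 1 / N"
        unfolding \<sigma>_def
      proof (rule cSup_least)
        show "?E \<noteq> {}" using feas0 by blast
        fix \<epsilon> assume "\<epsilon> \<in> ?E"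
        then have "B + \<epsilon> * N \<le> 0" using BN_le by blast
        then show "\<epsilon> \<le> Sup ?E - 1 / N"
          using BN N unfolding \<sigma>_def[symmetric] by (simp add: field_simps)
      qed
      then show ?case using N by simp
    qed
    then obtain \<delta> where "margin_feasible a C \<delta> \<sigma>" by metis
    then have "margin_solution a C \<delta>" using le_\<sigma> unfolding margin_solution_def by metis
    then show thesis by (rule that)
  qed
qed

lemma margin_solution_separating:
  assumes "margin_solution a C \<delta>"
  shows "separating_power_diagram a (power_diagram a \<delta>) C"
proof -
  obtain \<epsilon> where \<epsilon>: "margin_feasible a C \<delta> \<epsilon>" using assms unfolding margin_solution_def by metis
  have "(a $ l - a $ i) \<bullet> z \<le> \<delta> $ l - \<delta> $ i" if "l \<noteq> i" "z \<in> C i" for i l z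
  proof -
    have "0 \<le> \<epsilon> * norm (a $ l - a $ i)" using \<epsilon> by (simp add: margin_feasible_def)
    moreover have "(a $ l - a $ i) \<bullet> z + \<epsilon> * norm (a $ l - a $ i) \<le> \<delta> $ l - \<delta> $ i"
      using \<epsilon> that by (auto simp: margin_feasible_def)
    ultimately show ?thesis by linarith
  qed
  then show ?thesis by (auto simp: separating_power_diagram_def power_diagram_def)
qed

lemma shared_system_shared:
  "shared_system a C D \<gamma> \<Longrightarrow> shared_power_diagram a (power_diagram a \<gamma>) C D"
  by (auto simp: shared_system_def shared_power_diagram_def separating_power_diagram_def power_diagram_def)

section \<open>Runs of the algorithm\<close>

locale rad_to_rad = bounded_clusterings x kmin kmax
  for x :: "'n::finite \<Rightarrow> real^'d" and kmin kmax :: "'k::{finite,linorder} \<Rightarrow> nat" +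
  fixes s t :: "(real^'d, 'k) vec" and Ct :: "'k \<Rightarrow> (real^'d) set"
  assumes feasible_Ct: "feasible Ct"
    and optimal_Ct: "objective x t \<in> normal_cone x kmin kmax Ct"
begin

abbreviation step :: "('d, 'k) state \<Rightarrow> ('d, 'k) state \<Rightarrow> bool" where
  "step \<equiv> rad_step x kmin kmax s t Ct"

abbreviation sites :: "real \<Rightarrow> (real^'d, 'k) vec" where
  "sites \<equiv> sites_at s t"

definition optimal_at :: "real \<Rightarrow> ('k \<Rightarrow> (real^'d) set) \<Rightarrow> bool" where
  "optimal_at lam C \<longleftrightarrow> feasible C \<and> objective x (sites lam) \<in> normal_cone x kmin kmax C"

lemma optimal_at_iff_radial: "optimal_at lam C \<longleftrightarrow> radial (range x) kmin kmax (sites lam) C"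
  by (simp add: optimal_at_def radial_iff)

lemma sites_1: "sites 1 = t"
  by (simp add: sites_at_def)

lemma finite_cluster: "feasible C \<Longrightarrow> finite (C i)"
  unfolding feasible_def clustering_def by (metis UN_I UNIV_I finite_imageI finite finite_subset subsetI)

section \<open>Solvability of the subproblems and completion of runs\<close>

lemma shared_system_solvable:
  assumes "optimal_at \<mu> C" "optimal_at \<mu> D"
  obtains \<gamma> where "shared_system (sites \<mu>) C D \<gamma>"
proof -
  obtain \<gamma> :: "(real, 'k) vec" where \<gamma>: "\<And>D i l z. feasible D \<Longrightarrow>
      objective x (sites \<mu>) \<in> normal_cone x kmin kmax D \<Longrightarrow> z \<in> D i \<Longrightarrow>
      (sites \<mu> $ l - sites \<mu> $ i) \<bullet> z \<le> \<gamma> $ l - \<gamma> $ i"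
    using optimal_separable[of C "sites \<mu>"] assms(1) unfolding optimal_at_def by metis
  have "shared_system (sites \<mu>) C D (\<chi> i. \<gamma> $ i - \<gamma> $ first_label)"
    using \<gamma>[of C] \<gamma>[of D] assms by (simp add: shared_system_def optimal_at_def)
  then show thesis by (rule that)
qed

lemma margin_solvable:
  assumes "optimal_at lam C" "optimal_at \<mu> C"
  obtains \<delta> where "margin_solution ((1/2) *\<^sub>R (sites lam + sites \<mu>)) C \<delta>"
proof -
  let ?m = "(1/2) *\<^sub>R (sites lam + sites \<mu>)"
  have C: "feasible C" using assms(1) by (simp add: optimal_at_def)
  have "objective x ?m \<in> normal_cone x kmin kmax C"
    using assms by (intro objective_midpoint_in_normal_cone) (simp_all add: optimal_at_def)
  then obtain \<gamma> :: "(real, 'k) vec" where \<gamma>: "\<And>i l z. z \<in> C i \<Longrightarrow> (?m $ l - ?m $ i) \<bullet> z \<le> \<gamma> $ l - \<gamma> $ i"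
    using optimal_separable[OF C, of ?m] C by metis
  show thesis
    by (rule margin_solution_exists[OF finite_cluster[OF C] \<gamma>]) (assumption | rule that)+
qed

text \<open>Both subproblems are solvable, so progress depends only on finding an adjacent
  clustering optimal at the breakpoint.\<close>

lemma step_exists:
  assumes last: "last Cls \<noteq> Ct" "optimal_at (last ls) (last Cls)"
    and \<mu>: "next_breakpoint x kmin kmax s t (last Cls) (last ls) \<mu>"
    and D: "adjacent x kmin kmax (last Cls) D" "optimal_at \<mu> D"
  obtains Ds' where "step (ls, Cls, Ds) (ls @ [\<mu>], Cls @ [D], Ds')"
proof -
  let ?m = "(1/2) *\<^sub>R (sites (last ls) + sites \<mu>)"
  have opt: "optimal_at \<mu> (last Cls)" using last(2) \<mu> by (simp add: optimal_at_def next_breakpoint_def)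
  obtain \<gamma> where \<gamma>: "shared_system (sites \<mu>) (last Cls) D \<gamma>" using shared_system_solvable[OF opt D(2)] .
  obtain \<delta> where \<delta>: "margin_solution ?m (last Cls) \<delta>" using margin_solvable[OF last(2) opt] .
  have cone: "objective x (sites \<mu>) \<in> normal_cone x kmin kmax (last Cls) \<inter> normal_cone x kmin kmax D"
    using opt D(2) by (simp add: optimal_at_def)
  let ?Ps = "if 2 \<le> length Cls then [power_diagram ?m \<delta>] else []"
  have "step (ls, Cls, Ds) (ls @ [\<mu>], Cls @ [D], Ds @ ?Ps @ [power_diagram (sites \<mu>) \<gamma>])"
    using \<delta> by (intro rad_step.intros[OF last(1) \<mu> D(1) cone \<gamma> refl]) auto
  then show thesis by (rule that)
qed

text \<open>Final phase: the current clustering is optimal for \<open>t\<close> but may differ from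
  the target. The breakpoint is then 1, and moves inside the optimal face for \<open>t\<close>
  increase the agreement with \<open>Ct\<close>.\<close>

lemma exists_final_of_optimal_for_target:
  assumes "optimal_at (last ls) (last Cls)" "last ls \<le> 1" "optimal_at 1 (last Cls)"
  shows "\<exists>st'. step\<^sup>*\<^sup>* (ls, Cls, Ds) st' \<and> rad_final Ct st'"
  using assms
proof (induction "card {E. feasible E \<and> ind Ct \<bullet> ind (last Cls) < ind Ct \<bullet> ind E}"
    arbitrary: ls Cls Ds rule: less_induct)
  case less
  let ?C = "last Cls"
  show ?case
  proof (cases "?C = Ct")
    case True
    then show ?thesis by (intro exI[of _ "(ls, Cls, Ds)"]) (simp add: rad_final_def)
  next
    case False
    have C: "feasible ?C" "objective x t \<in> normal_cone x kmin kmax ?C"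
      using less.prems(3) by (simp_all add: optimal_at_def sites_1)
    have bp: "next_breakpoint x kmin kmax s t ?C (last ls) 1"
      using less.prems C(2) by (auto simp: next_breakpoint_def sites_1)
    have eq: "objective x t \<bullet> ind Ct = objective x t \<bullet> ind ?C"
      using C feasible_Ct optimal_Ct normal_cone_iff by (metis order_antisym)
    obtain D where D: "feasible D" "adjacent x kmin kmax ?C D" "objective x t \<in> normal_cone x kmin kmax D"
      "ind Ct \<bullet> ind ?C < ind Ct \<bullet> ind D"
      by (rule improving_adjacent[OF C ind_in_T[OF feasible_Ct] eq
            ind_inner_less[OF C(1) feasible_Ct False]])
    have opt: "optimal_at 1 D" using D by (simp add: optimal_at_def sites_1)
    obtain Ds' where st: "step (ls, Cls, Ds) (ls @ [1], Cls @ [D], Ds')"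
      using step_exists[OF False less.prems(1) bp D(2) opt] .
    have "\<exists>st'. step\<^sup>*\<^sup>* (ls @ [1], Cls @ [D], Ds') st' \<and> rad_final Ct st'"
      by (rule less.hyps) (use card_better_less[OF D(1,4)] opt in simp_all)
    then show ?thesis using st by (meson converse_rtranclp_into_rtranclp)
  qed
qed

text \<open>First phase: until the clustering is optimal for \<open>t\<close>, the breakpoint is
  below 1 and admits a step that increases \<open>c(t) - c(s)\<close>. Afterwards the final phase
  takes over.\<close>

lemma exists_final:
  assumes "optimal_at (last ls) (last Cls)" "last ls \<le> 1"
  shows "\<exists>st'. step\<^sup>*\<^sup>* (ls, Cls, Ds) st' \<and> rad_final Ct st'"
  using assms
proof (induction "card {E. feasible E \<and> (objective x t - objective x s) \<bullet> ind (last Cls)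
      < (objective x t - objective x s) \<bullet> ind E}" arbitrary: ls Cls Ds rule: less_induct)
  case less
  let ?C = "last Cls" and ?g = "objective x t - objective x s"
  show ?case
  proof (cases "?C = Ct \<or> optimal_at 1 ?C")
    case True
    then have "optimal_at 1 ?C" using feasible_Ct optimal_Ct by (auto simp: optimal_at_def sites_1)
    then show ?thesis using exists_final_of_optimal_for_target less.prems by metis
  next
    case False
    have C: "feasible ?C" "objective x (sites (last ls)) \<in> normal_cone x kmin kmax ?C"
      using less.prems(1) by (simp_all add: optimal_at_def)
    obtain \<mu> where \<mu>: "next_breakpoint x kmin kmax s t ?C (last ls) \<mu>"
      using next_breakpoint_exists[OF less.prems(2) C(2)] .
    have opt: "objective x (sites \<mu>) \<in> normal_cone x kmin kmax ?C" and "\<mu> \<le> 1"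
      using \<mu> by (simp_all add: next_breakpoint_def)
    moreover have "\<mu> \<noteq> 1" using opt False C(1) by (auto simp: optimal_at_def)
    ultimately have "\<mu> < 1" by simp
    then obtain E where E: "feasible E" "objective x (sites \<mu>) \<bullet> ind E = objective x (sites \<mu>) \<bullet> ind ?C"
      "?g \<bullet> ind ?C < ?g \<bullet> ind E"
      by (rule next_breakpoint_improving[OF C(1) \<mu>])
    obtain D where D: "feasible D" "adjacent x kmin kmax ?C D"
      "objective x (sites \<mu>) \<in> normal_cone x kmin kmax D" "?g \<bullet> ind ?C < ?g \<bullet> ind D"
      by (rule improving_adjacent[OF C(1) opt ind_in_T[OF E(1)] E(2,3)])
    have optD: "optimal_at \<mu> D" using D by (simp add: optimal_at_def)
    obtain Ds' where st: "step (ls, Cls, Ds) (ls @ [\<mu>], Cls @ [D], Ds')"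
      using step_exists[OF _ less.prems(1) \<mu> D(2) optD] False by metis
    have "\<exists>st'. step\<^sup>*\<^sup>* (ls @ [\<mu>], Cls @ [D], Ds') st' \<and> rad_final Ct st'"
      by (rule less.hyps) (use card_better_less[OF D(1,4)] optD \<open>\<mu> \<le> 1\<close> in simp_all)
    then show ?thesis using st by (meson converse_rtranclp_into_rtranclp)
  qed
qed

text \<open>Loop invariant after \<open>r\<close> iterations. Shared and separating diagrams
  alternate, at positions \<open>2 * i - 2\<close> and \<open>2 * i - 1\<close> counted from 0;
  truncated subtraction gives length 0 for \<open>r = 0\<close>.\<close>

definition run :: "('k \<Rightarrow> (real^'d) set) \<Rightarrow> nat \<Rightarrow> ('d, 'k) state \<Rightarrow> bool" where
  "run Cs r = (\<lambda>(ls, Cls, Ds).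
     length ls = r + 1 \<and> length Cls = r + 1 \<and> length Ds = 2 * r - 1 \<and> Cls ! 0 = Cs \<and>
     (\<forall>i\<le>r. ls ! i \<le> 1 \<and> optimal_at (ls ! i) (Cls ! i)) \<and>
     (\<forall>i\<in>{1..r}. single_cyclical_exchange (Cls ! (i - 1)) (Cls ! i) \<or>
        single_sequential_exchange (Cls ! (i - 1)) (Cls ! i)) \<and>
     (\<forall>i\<in>{1..<r}. separating_power_diagram
        ((1/2) *\<^sub>R (sites (ls ! i) + sites (ls ! (i + 1)))) (Ds ! (2 * i - 1)) (Cls ! i)) \<and>
     (\<forall>i\<in>{1..r}. shared_power_diagram (sites (ls ! i)) (Ds ! (2 * i - 2)) (Cls ! (i - 1)) (Cls ! i)))"

lemma run_step:
  assumes run: "run Cs r st" and step: "step st st'"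
  shows "run Cs (Suc r) st'"
  using step
proof (cases rule: rad_step.cases)
  case (1 Cls ls \<mu> D \<gamma> m Ps Ds)
  have len: "length ls = r + 1" "length Cls = r + 1" "length Ds = 2 * r - 1"
    and start: "Cls ! 0 = Cs"
    and opt: "\<And>i. i \<le> r \<Longrightarrow> ls ! i \<le> 1 \<and> optimal_at (ls ! i) (Cls ! i)"
    and exch: "\<And>i. i \<in> {1..r} \<Longrightarrow> single_cyclical_exchange (Cls ! (i - 1)) (Cls ! i) \<or>
        single_sequential_exchange (Cls ! (i - 1)) (Cls ! i)"
    and sep: "\<And>i. i \<in> {1..<r} \<Longrightarrow> separating_power_diagram
        ((1/2) *\<^sub>R (sites (ls ! i) + sites (ls ! (i + 1)))) (Ds ! (2 * i - 1)) (Cls ! i)"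
    and shared: "\<And>i. i \<in> {1..r} \<Longrightarrow>
        shared_power_diagram (sites (ls ! i)) (Ds ! (2 * i - 2)) (Cls ! (i - 1)) (Cls ! i)"
    using run unfolding run_def 1(1) by auto
  have last: "last ls = ls ! r" "last Cls = Cls ! r"
    using len by (metis add_diff_cancel_right' last_conv_nth length_0_conv Suc_eq_plus1 nat.distinct(1))+
  have \<mu>: "\<mu> \<le> 1" "optimal_at \<mu> D"
    using 1 by (auto simp: next_breakpoint_def optimal_at_def adjacent_def feasible_def)
  have new_exch: "single_cyclical_exchange (Cls ! r) D \<or> single_sequential_exchange (Cls ! r) D"
    using adjacent_imp_single_exchange[OF 1(5)] last by simp
  have new_shared: "shared_power_diagram (sites \<mu>) (power_diagram (sites \<mu>) \<gamma>) (Cls ! r) D"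
    using shared_system_shared[OF 1(7)] last by simp
  \<comment> \<open>The first iteration adds no separating diagram, every later one exactly
    one.\<close>
  have Ps: "Ps = []" if "r = 0" using 1(9) len that by simp
  obtain \<delta> where Ps': "0 < r \<Longrightarrow> Ps = [power_diagram m \<delta>] \<and> margin_solution m (Cls ! r) \<delta>"
    using 1(9) len last by (cases "r = 0") auto
  have new_sep: "separating_power_diagram ((1/2) *\<^sub>R (sites (ls ! r) + sites \<mu>)) (Ps ! 0) (Cls ! r)" if "0 < r"
    using margin_solution_separating Ps'[OF that] 1(8) last by auto
  have lenPs: "length Ps = (if r = 0 then 0 else 1)" using Ps Ps' by auto
  have nth_Ds: "(Ds @ Ps @ [P]) ! (2 * i - 1) = Ds ! (2 * i - 1)" if "i \<in> {1..<r}" for i P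
  proof -
    have "2 * i - 1 < length Ds" using that len(3) by auto
    then show ?thesis by (simp add: nth_append)
  qed
  have nth_Ds': "(Ds @ Ps @ [P]) ! (2 * i - 2) = Ds ! (2 * i - 2)" if "i \<in> {1..r}" for i P
  proof -
    have "2 * i - 2 < length Ds" using that len(3) by auto
    then show ?thesis by (simp add: nth_append)
  qed
  \<comment> \<open>The new shared diagram has index \<open>2 * r\<close> also for
    \<open>r = 0\<close>, where both lists before it are empty.\<close>
  have nth_P: "(Ds @ Ps @ [P]) ! (2 * r) = P" for P
  proof -
    have "2 * r = length Ds + length Ps" using len(3) lenPs by auto
    then show ?thesis by (simp add: nth_append)
  qed
  have nth_Ps: "(Ds @ Ps @ [P]) ! (2 * r - 1) = Ps ! 0" if "0 < r" for P
    using len(3) lenPs that by (simp add: nth_append)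
  show ?thesis
    unfolding run_def 1(2) prod.case
  proof (intro conjI ballI allI impI)
    show "length (ls @ [\<mu>]) = Suc r + 1" "length (Cls @ [D]) = Suc r + 1"
      "length (Ds @ Ps @ [power_diagram (sites \<mu>) \<gamma>]) = 2 * Suc r - 1"
      using len lenPs by auto
    show "(Cls @ [D]) ! 0 = Cs" using start len by (simp add: nth_append)
  next
    fix i assume i: "i \<le> Suc r"
    show "(ls @ [\<mu>]) ! i \<le> 1" "optimal_at ((ls @ [\<mu>]) ! i) ((Cls @ [D]) ! i)"
      using i \<mu> opt[of i] len by (cases "i = Suc r"; simp add: nth_append)+
  next
    fix i assume i: "i \<in> {1..Suc r}"
    show "single_cyclical_exchange ((Cls @ [D]) ! (i - 1)) ((Cls @ [D]) ! i) \<or>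
        single_sequential_exchange ((Cls @ [D]) ! (i - 1)) ((Cls @ [D]) ! i)"
      using i new_exch exch[of i] len by (cases "i = Suc r") (auto simp: nth_append)
    show "shared_power_diagram (sites ((ls @ [\<mu>]) ! i))
        ((Ds @ Ps @ [power_diagram (sites \<mu>) \<gamma>]) ! (2 * i - 2)) ((Cls @ [D]) ! (i - 1)) ((Cls @ [D]) ! i)"
    proof (cases "i = Suc r")
      case True
      then show ?thesis using new_shared len nth_P by (simp add: nth_append)
    next
      case False
      then have "i \<in> {1..r}" "i - 1 < Suc r" using i by auto
      then show ?thesis using shared[of i] nth_Ds'[of i] len by (simp add: nth_append)
    qed
  next
    fix i assume i: "i \<in> {1..<Suc r}"
    show "separating_power_diagram ((1/2) *\<^sub>R (sites ((ls @ [\<mu>]) ! i) + sites ((ls @ [\<mu>]) ! (i + 1))))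
        ((Ds @ Ps @ [power_diagram (sites \<mu>) \<gamma>]) ! (2 * i - 1)) ((Cls @ [D]) ! i)"
    proof (cases "i = r")
      case True
      then show ?thesis using new_sep len nth_Ps i by (simp add: nth_append)
    next
      case False
      then have "i \<in> {1..<r}" using i by simp
      then show ?thesis using sep[of i] nth_Ds[of i] len by (simp add: nth_append)
    qed
  qed
qed

lemma run_reaches:
  assumes "optimal_at 0 Cs" "step\<^sup>*\<^sup>* (rad_init Cs) st"
  shows "\<exists>r. run Cs r st"
  using assms(2)
proof (induction rule: rtranclp_induct)
  case base
  have "run Cs 0 (rad_init Cs)" using assms(1) by (simp add: run_def rad_init_def)
  then show ?case by blast
next
  case (step st st')
  then show ?case using run_step by blast
qed

lemma run_last:
  assumes "run Cs r (ls, Cls, Ds)"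
  shows "last ls = ls ! r" "last Cls = Cls ! r" "last ls \<le> 1" "optimal_at (last ls) (last Cls)"
proof -
  have len: "length ls = r + 1" "length Cls = r + 1" using assms by (simp_all add: run_def)
  then have "ls \<noteq> []" "Cls \<noteq> []" by auto
  then show last: "last ls = ls ! r" "last Cls = Cls ! r" using len by (simp_all add: last_conv_nth)
  show "last ls \<le> 1" "optimal_at (last ls) (last Cls)"
    unfolding last using assms by (simp_all add: run_def)
qed

end

text \<open>The choices in the loop are left open. Hence the ability to return is expressed in two
  ways, some run ends and every partial run can be continued to an end, and the properties are shown
  for every possible result.\<close>

theorem theorem3:
  fixes x :: "'n::finite \<Rightarrow> real^'d"
    and s t :: "real^'d^'k::{finite,linorder}"
    and kmin kmax :: "'k \<Rightarrow> nat"
    and Cs Ct :: "'k \<Rightarrow> (real^'d) set"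
  assumes "inj x" and "(\<Sum>j\<in>UNIV. x j) = 0"
    and "kmin \<le> kmax"
    and "within_bounds kmin kmax Cs" and "within_bounds kmin kmax Ct"
    and "radial (range x) kmin kmax s Cs"
    and "radial (range x) kmin kmax t Ct"
  shows
    "(\<exists>st. algo_rad_to_rad_returns x Cs Ct s t kmin kmax st) \<and>
     (\<forall>st. rad_reaches x kmin kmax s t Ct (rad_init Cs) st \<longrightarrow>
        (\<exists>st'. rad_reaches x kmin kmax s t Ct st st' \<and> rad_final Ct st')) \<and>
     (\<forall>ls Cls Ds. algo_rad_to_rad_returns x Cs Ct s t kmin kmax (ls, Cls, Ds) \<longrightarrow>
        (\<exists>r. length ls = r + 1 \<and> length Cls = r + 1 \<and> length Ds = 2 * r - 1 \<and>
           (Cls ! 0 = Cs \<and> Cls ! r = Ct) \<and>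
           (\<forall>i\<le>r. radial (range x) kmin kmax (sites_at s t (ls ! i)) (Cls ! i)) \<and>
           (\<forall>C\<in>set Cls. \<forall>i. kmin i \<le> card (C i) \<and> card (C i) \<le> kmax i) \<and>
           (\<forall>i\<in>{1..r}. single_cyclical_exchange (Cls ! (i - 1)) (Cls ! i) \<or>
                        single_sequential_exchange (Cls ! (i - 1)) (Cls ! i)) \<and>
           (\<forall>i\<in>{1..<r}. separating_power_diagram
                ((1/2) *\<^sub>R (sites_at s t (ls ! i) + sites_at s t (ls ! (i + 1))))
                (Ds ! (2 * i - 1)) (Cls ! i)) \<and>
           (\<forall>i\<in>{1..r}. shared_power_diagram (sites_at s t (ls ! i))
                (Ds ! (2 * i - 2)) (Cls ! (i - 1)) (Cls ! i))))"
proof -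
  interpret B: bounded_clusterings x kmin kmax by unfold_locales (rule assms(1))
  interpret rad_to_rad x kmin kmax s t Ct
    by unfold_locales (use assms(7) in \<open>simp_all add: B.radial_iff\<close>)
  have init: "optimal_at 0 Cs"
    using assms(6) by (simp add: optimal_at_iff_radial sites_at_def)
  have final: "\<exists>st'. rad_reaches x kmin kmax s t Ct st st' \<and> rad_final Ct st'"
    if st: "rad_reaches x kmin kmax s t Ct (rad_init Cs) st" for st
  proof -
    obtain ls Cls Ds where eq: "st = (ls, Cls, Ds)" by (cases st)
    obtain r where "run Cs r (ls, Cls, Ds)"
      using run_reaches[OF init] st unfolding rad_reaches_def eq by metis
    \<comment> \<open>By the invariant the last clustering of a reachable state is optimal at its
      parameter, so the run can be completed from there.\<close>
    then show ?thesis
      unfolding eq rad_reaches_def by (intro exists_final run_last)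
  qed
  show ?thesis
  proof (intro conjI allI impI)
    show "\<exists>st. algo_rad_to_rad_returns x Cs Ct s t kmin kmax st"
      using final[of "rad_init Cs"] by (simp add: algo_rad_to_rad_returns_def rad_reaches_def)
  next
    fix st assume "rad_reaches x kmin kmax s t Ct (rad_init Cs) st"
    then show "\<exists>st'. rad_reaches x kmin kmax s t Ct st st' \<and> rad_final Ct st'" by (rule final)
  next
    fix ls Cls Ds assume "algo_rad_to_rad_returns x Cs Ct s t kmin kmax (ls, Cls, Ds)"
    then have reach: "step\<^sup>*\<^sup>* (rad_init Cs) (ls, Cls, Ds)" and fin: "last Cls = Ct"
      by (simp_all add: algo_rad_to_rad_returns_def rad_reaches_def rad_final_def)
    obtain r where run: "run Cs r (ls, Cls, Ds)" using run_reaches[OF init reach] by blast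
    have opt: "\<And>i. i \<le> r \<Longrightarrow> optimal_at (ls ! i) (Cls ! i)" and len: "length Cls = r + 1"
      using run by (simp_all add: run_def)
    have "within_bounds kmin kmax C" if C: "C \<in> set Cls" for C
    proof -
      obtain i where "i < length Cls" "Cls ! i = C" using C by (auto simp: in_set_conv_nth)
      then show ?thesis using opt[of i] len by (simp add: optimal_at_def B.feasible_def)
    qed
    then have "\<forall>C\<in>set Cls. \<forall>i. kmin i \<le> card (C i) \<and> card (C i) \<le> kmax i"
      by (simp add: within_bounds_def)
    moreover have "\<forall>i\<le>r. radial (range x) kmin kmax (sites_at s t (ls ! i)) (Cls ! i)"
      using opt by (simp add: optimal_at_iff_radial)
    moreover have "Cls ! r = Ct" using fin run_last(2)[OF run] by simp
    ultimately show "\<exists>r. length ls = r + 1 \<and> length Cls = r + 1 \<and> length Ds = 2 * r - 1 \<and>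
           (Cls ! 0 = Cs \<and> Cls ! r = Ct) \<and>
           (\<forall>i\<le>r. radial (range x) kmin kmax (sites_at s t (ls ! i)) (Cls ! i)) \<and>
           (\<forall>C\<in>set Cls. \<forall>i. kmin i \<le> card (C i) \<and> card (C i) \<le> kmax i) \<and>
           (\<forall>i\<in>{1..r}. single_cyclical_exchange (Cls ! (i - 1)) (Cls ! i) \<or>
                        single_sequential_exchange (Cls ! (i - 1)) (Cls ! i)) \<and>
           (\<forall>i\<in>{1..<r}. separating_power_diagram
                ((1/2) *\<^sub>R (sites_at s t (ls ! i) + sites_at s t (ls ! (i + 1))))
                (Ds ! (2 * i - 1)) (Cls ! i)) \<and>
           (\<forall>i\<in>{1..r}. shared_power_diagram (sites_at s t (ls ! i))
                (Ds ! (2 * i - 2)) (Cls ! (i - 1)) (Cls ! i))"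
      using run unfolding run_def prod.case by (intro exI[of _ r]) blast
  qed
qed

end
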